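(* Let $\mathcal F$ be a unital $C^*$-algebra and $\mathcal C\subset\mathcal F$ a set of self-adjoint elements. Let $\mathcal D=[\mathcal F\mathcal C]\cap[\mathcal C\mathcal F]$, and let $\mathcal O=\mathcal D_W=\{F\in\mathcal F : FH-HF\in\mathcal D\ \ \forall H\in\mathcal D\}$ (so that $\mathcal D$ is a closed two-sided ideal of the $C^*$-algebra $\mathcal O$). Let $\mathcal N_{\mathcal J}$ and $\mathcal J$ be the self-adjoint parts of $\mathcal O$ and $\mathcal D$ respectively, so that $\mathcal O=\mathcal N_{\mathcal J}\oplus i\mathcal N_{\mathcal J}$ and $\mathcal D=\mathcal J\oplus i\mathcal J$, and let $\widetilde{\mathcal L}$ be the self-adjoint part of the $C^*$-algebra $\mathcal O/\mathcal D$. Then $$\widetilde{\mathcal L}=\mathcal N_{\mathcal J}/\mathcal J ,$$ as Lie--Jordan Banach algebras, under the natural identification $n+\mathcal J\leftrightarrow n+\mathcal D$, $n\in\mathcal N_{\mathcal J}$.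
   Context: $[\,\cdot\,]$ denotes the closed linear span, so $[\mathcal F\mathcal C]$ (resp. $[\mathcal C\mathcal F]$) is the closed linear span of all products $FC$ (resp. $CF$) with $F\in\mathcal F$, $C\in\mathcal C$. The self-adjoint part of a $C^*$-algebra is regarded as a Lie--Jordan Banach algebra with Jordan product $a\circ b=\frac12(ab+ba)$, bracket $[a,b]_\lambda=i\lambda(ab-ba)$ for a fixed nonzero $\lambda\in\mathbb R$, and the restricted norm. The quotient $\mathcal N_{\mathcal J}/\mathcal J$ carries the induced Jordan product and bracket and the quotient norm. *)

theory Defs
  imports "HOL-Analysis.Analysis" "HOL-Algebra.QuotRing" "HOL-Algebra.Algebraic_Closure_Type"
begin

hide_const (open) Polynomial.smult

section \<open>Unital C*-algebras as a type class\<close>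

text \<open>The sort \<^class>\<open>monoid_mult\<close> rather than \<^class>\<open>real_normed_algebra_1\<close> supplies the unit, so
  that the zero algebra is admitted; otherwise \<open>norm 1 = 1\<close> follows from the C*-identity.\<close>

class unital_cstar_algebra = real_normed_algebra + banach + monoid_mult +
  fixes scaleC :: "complex \<Rightarrow> 'a \<Rightarrow> 'a" (infixr \<open>*\<^sub>C\<close> 75)
    and star :: "'a \<Rightarrow> 'a"
  assumes scaleC_of_real: "complex_of_real r *\<^sub>C x = r *\<^sub>R x"
    and scaleC_add_right: "c *\<^sub>C (x + y) = c *\<^sub>C x + c *\<^sub>C y"
    and scaleC_add_left: "(c + d) *\<^sub>C x = c *\<^sub>C x + d *\<^sub>C x"
    and scaleC_scaleC: "c *\<^sub>C (d *\<^sub>C x) = (c * d) *\<^sub>C x"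
    and mult_scaleC_left: "(c *\<^sub>C x) * y = c *\<^sub>C (x * y)"
    and mult_scaleC_right: "x * (c *\<^sub>C y) = c *\<^sub>C (x * y)"
    and norm_scaleC: "norm (c *\<^sub>C x) = cmod c * norm x"
    and star_star: "star (star x) = x"
    and star_add: "star (x + y) = star x + star y"
    and star_scaleC: "star (c *\<^sub>C x) = cnj c *\<^sub>C star x"
    and star_mult: "star (x * y) = star y * star x"
    and cstar_identity: "norm (star x * x) = norm x ^ 2"

global_interpretation cvec: vector_space "scaleC :: complex \<Rightarrow> 'a \<Rightarrow> 'a::unital_cstar_algebra"
  defines cspan = cvec.span
proof
  fix c d :: complex and x y :: 'a
  show "c *\<^sub>C (x + y) = c *\<^sub>C x + c *\<^sub>C y" by (rule scaleC_add_right)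
  show "(c + d) *\<^sub>C x = c *\<^sub>C x + d *\<^sub>C x" by (rule scaleC_add_left)
  show "c *\<^sub>C (d *\<^sub>C x) = (c * d) *\<^sub>C x" by (rule scaleC_scaleC)
  show "1 *\<^sub>C x = x" using scaleC_of_real[of 1 x] by simp
qed

definition closed_cspan :: "'a::unital_cstar_algebra set \<Rightarrow> 'a set" where
  "closed_cspan S = closure (cspan S)"

definition weak_commutant :: "'a::unital_cstar_algebra set \<Rightarrow> 'a set" where
  "weak_commutant S = {F. \<forall>H\<in>S. F * H - H * F \<in> S}"

definition self_adjoint :: "'a::unital_cstar_algebra set \<Rightarrow> 'a set" where
  "self_adjoint S = {x \<in> S. star x = x}"

section \<open>Algebras with explicit carrier\<close>

text \<open>Subalgebras and quotients depend on the given set of constraints, hence are not types; they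
  are rendered as HOL-Algebra records.\<close>

record ('k, 'a) normed_module = "('k, 'a) module" +
  nrm :: "'a \<Rightarrow> real"

locale banach_space_on =
  Module.module "ring_of_type_algebra :: 'k ring" V
  for V :: "('k::real_normed_field, 'a, 'm) normed_module_scheme" (structure) +
  assumes nrm_nonneg: "x \<in> carrier V \<Longrightarrow> 0 \<le> nrm V x"
    and nrm_eq_0_iff: "x \<in> carrier V \<Longrightarrow> nrm V x = 0 \<longleftrightarrow> x = \<zero>"
    and nrm_triangle: "\<lbrakk>x \<in> carrier V; y \<in> carrier V\<rbrakk> \<Longrightarrow> nrm V (x \<oplus> y) \<le> nrm V x + nrm V y"
    and nrm_smult: "x \<in> carrier V \<Longrightarrow> nrm V (c \<odot> x) = norm c * nrm V x"
    and nrm_complete: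
      "\<lbrakk>\<And>n::nat. s n \<in> carrier V;
        \<And>e. 0 < e \<Longrightarrow> \<exists>M. \<forall>m\<ge>M. \<forall>n\<ge>M. nrm V (s m \<ominus> s n) < e\<rbrakk>
       \<Longrightarrow> \<exists>x\<in>carrier V. (\<lambda>n. nrm V (s n \<ominus> x)) \<longlonglongrightarrow> 0"

record 'a star_algebra = "(complex, 'a) normed_module" +
  adj :: "'a \<Rightarrow> 'a"

locale unital_cstar_algebra_on = Ring.ring A + banach_space_on A
  for A :: "('a, 'm) star_algebra_scheme" (structure) +
  assumes smult_mult_left:
      "\<lbrakk>x \<in> carrier A; y \<in> carrier A\<rbrakk> \<Longrightarrow> (c \<odot> x) \<otimes> y = c \<odot> (x \<otimes> y)"
    and smult_mult_right:
      "\<lbrakk>x \<in> carrier A; y \<in> carrier A\<rbrakk> \<Longrightarrow> x \<otimes> (c \<odot> y) = c \<odot> (x \<otimes> y)"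
    and nrm_mult: "\<lbrakk>x \<in> carrier A; y \<in> carrier A\<rbrakk> \<Longrightarrow> nrm A (x \<otimes> y) \<le> nrm A x * nrm A y"
    and adj_closed: "x \<in> carrier A \<Longrightarrow> adj A x \<in> carrier A"
    and adj_adj: "x \<in> carrier A \<Longrightarrow> adj A (adj A x) = x"
    and adj_add: "\<lbrakk>x \<in> carrier A; y \<in> carrier A\<rbrakk> \<Longrightarrow> adj A (x \<oplus> y) = adj A x \<oplus> adj A y"
    and adj_smult: "x \<in> carrier A \<Longrightarrow> adj A (c \<odot> x) = cnj c \<odot> adj A x"
    and adj_mult: "\<lbrakk>x \<in> carrier A; y \<in> carrier A\<rbrakk> \<Longrightarrow> adj A (x \<otimes> y) = adj A y \<otimes> adj A x"
    and nrm_adj_mult: "x \<in> carrier A \<Longrightarrow> nrm A (adj A x \<otimes> x) = nrm A x ^ 2"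

definition cstar_sub :: "'a::unital_cstar_algebra set \<Rightarrow> 'a star_algebra" where
  "cstar_sub S =
    \<lparr>carrier = S, monoid.mult = (*), one = 1, ring.zero = 0, add = (+), smult = scaleC,
     nrm = norm, adj = star\<rparr>"

section \<open>Lie--Jordan Banach algebras\<close>

text \<open>The field \<^const>\<open>monoid.mult\<close> holds the Jordan product.\<close>

record 'a lie_jordan_algebra = "(real, 'a) normed_module" +
  lie :: "'a \<Rightarrow> 'a \<Rightarrow> 'a"

text \<open>The constant \<open>hbar\<close> is the one in the associator identity.  For the bracket
  \<open>\<i> * lam * (a * b - b * a)\<close> on the self-adjoint part of a C*-algebra it is \<open>1 / (2 * lam)\<close>.\<close>

locale lie_jordan_banach_algebra = banach_space_on L
  for hbar :: real and L :: "('a, 'm) lie_jordan_algebra_scheme" (structure) +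
  assumes hbar_nonzero: "hbar \<noteq> 0"
    and jordan_closed: "\<lbrakk>a \<in> carrier L; b \<in> carrier L\<rbrakk> \<Longrightarrow> a \<otimes> b \<in> carrier L"
    and jordan_commute: "\<lbrakk>a \<in> carrier L; b \<in> carrier L\<rbrakk> \<Longrightarrow> a \<otimes> b = b \<otimes> a"
    and jordan_add: "\<lbrakk>a \<in> carrier L; b \<in> carrier L; c \<in> carrier L\<rbrakk>
      \<Longrightarrow> (a \<oplus> b) \<otimes> c = (a \<otimes> c) \<oplus> (b \<otimes> c)"
    and jordan_smult: "\<lbrakk>a \<in> carrier L; b \<in> carrier L\<rbrakk> \<Longrightarrow> (r \<odot> a) \<otimes> b = r \<odot> (a \<otimes> b)"
    and jordan_identity: "\<lbrakk>a \<in> carrier L; b \<in> carrier L\<rbrakk>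
      \<Longrightarrow> ((a \<otimes> a) \<otimes> b) \<otimes> a = (a \<otimes> a) \<otimes> (b \<otimes> a)"
    and lie_closed: "\<lbrakk>a \<in> carrier L; b \<in> carrier L\<rbrakk> \<Longrightarrow> lie L a b \<in> carrier L"
    and lie_antisym: "\<lbrakk>a \<in> carrier L; b \<in> carrier L\<rbrakk> \<Longrightarrow> lie L a b = \<ominus> lie L b a"
    and lie_add: "\<lbrakk>a \<in> carrier L; b \<in> carrier L; c \<in> carrier L\<rbrakk>
      \<Longrightarrow> lie L (a \<oplus> b) c = lie L a c \<oplus> lie L b c"
    and lie_smult: "\<lbrakk>a \<in> carrier L; b \<in> carrier L\<rbrakk> \<Longrightarrow> lie L (r \<odot> a) b = r \<odot> lie L a b"
    and jacobi: "\<lbrakk>a \<in> carrier L; b \<in> carrier L; c \<in> carrier L\<rbrakk>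
      \<Longrightarrow> lie L a (lie L b c) \<oplus> lie L b (lie L c a) \<oplus> lie L c (lie L a b) = \<zero>"
    and leibniz: "\<lbrakk>a \<in> carrier L; b \<in> carrier L; c \<in> carrier L\<rbrakk>
      \<Longrightarrow> lie L a (b \<otimes> c) = (lie L a b \<otimes> c) \<oplus> (b \<otimes> lie L a c)"
    and associator: "\<lbrakk>a \<in> carrier L; b \<in> carrier L; c \<in> carrier L\<rbrakk>
      \<Longrightarrow> ((a \<otimes> b) \<otimes> c) \<ominus> (a \<otimes> (b \<otimes> c)) = hbar ^ 2 \<odot> lie L b (lie L c a)"
    and nrm_jordan: "\<lbrakk>a \<in> carrier L; b \<in> carrier L\<rbrakk> \<Longrightarrow> nrm L (a \<otimes> b) \<le> nrm L a * nrm L b"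
    and nrm_lie: "\<lbrakk>a \<in> carrier L; b \<in> carrier L\<rbrakk>
      \<Longrightarrow> nrm L (lie L a b) \<le> inverse \<bar>hbar\<bar> * nrm L a * nrm L b"
    and nrm_square: "a \<in> carrier L \<Longrightarrow> nrm L (a \<otimes> a) = nrm L a ^ 2"
    and nrm_square_add: "\<lbrakk>a \<in> carrier L; b \<in> carrier L\<rbrakk>
      \<Longrightarrow> nrm L (a \<otimes> a) \<le> nrm L ((a \<otimes> a) \<oplus> (b \<otimes> b))"

definition sa_part :: "real \<Rightarrow> ('a, 'm) star_algebra_scheme \<Rightarrow> 'a lie_jordan_algebra" where
  "sa_part lam A =
    \<lparr>carrier = {a \<in> carrier A. adj A a = a},
     monoid.mult = (\<lambda>a b. (1/2) \<odot>\<^bsub>A\<^esub> ((a \<otimes>\<^bsub>A\<^esub> b) \<oplus>\<^bsub>A\<^esub> (b \<otimes>\<^bsub>A\<^esub> a))),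
     one = \<one>\<^bsub>A\<^esub>, ring.zero = \<zero>\<^bsub>A\<^esub>, add = ring.add A,
     smult = (\<lambda>r. smult A (complex_of_real r)),
     nrm = nrm A,
     lie = (\<lambda>a b. (\<i> * complex_of_real lam) \<odot>\<^bsub>A\<^esub> ((a \<otimes>\<^bsub>A\<^esub> b) \<ominus>\<^bsub>A\<^esub> (b \<otimes>\<^bsub>A\<^esub> a)))\<rparr>"

definition lie_jordan_banach_iso ::
  "('a \<Rightarrow> 'b) \<Rightarrow> ('a, 'm) lie_jordan_algebra_scheme \<Rightarrow> ('b, 'n) lie_jordan_algebra_scheme \<Rightarrow> bool"
where
  "lie_jordan_banach_iso f L M \<longleftrightarrow>
    bij_betw f (carrier L) (carrier M) \<and>
    (\<forall>a\<in>carrier L. \<forall>b\<in>carrier L. f (a \<oplus>\<^bsub>L\<^esub> b) = f a \<oplus>\<^bsub>M\<^esub> f b) \<and>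
    (\<forall>r. \<forall>a\<in>carrier L. f (r \<odot>\<^bsub>L\<^esub> a) = r \<odot>\<^bsub>M\<^esub> f a) \<and>
    (\<forall>a\<in>carrier L. \<forall>b\<in>carrier L. f (a \<otimes>\<^bsub>L\<^esub> b) = f a \<otimes>\<^bsub>M\<^esub> f b) \<and>
    (\<forall>a\<in>carrier L. \<forall>b\<in>carrier L. f (lie L a b) = lie M (f a) (f b)) \<and>
    f \<one>\<^bsub>L\<^esub> = \<one>\<^bsub>M\<^esub> \<and>
    (\<forall>a\<in>carrier L. nrm M (f a) = nrm L a)"

section \<open>Quotients\<close>

text \<open>As in \<^const>\<open>rcoset_mult\<close>, an operation is induced on cosets by taking the union of the cosets
  of its values on all representatives.\<close>

definition coset_map :: "('a, 'm) ring_scheme \<Rightarrow> 'a set \<Rightarrow> ('a \<Rightarrow> 'a) \<Rightarrow> 'a set \<Rightarrow> 'a set" where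
  "coset_map A I f S = (\<Union>x\<in>S. I +>\<^bsub>A\<^esub> f x)"

definition coset_nrm :: "('k, 'a, 'm) normed_module_scheme \<Rightarrow> 'a set \<Rightarrow> real" where
  "coset_nrm A S = (INF x\<in>S. nrm A x)"

definition cstar_quot :: "('a, 'm) star_algebra_scheme \<Rightarrow> 'a set \<Rightarrow> 'a set star_algebra" where
  "cstar_quot A I =
    \<lparr>carrier = carrier (A Quot I), monoid.mult = monoid.mult (A Quot I), one = monoid.one (A Quot I),
     ring.zero = ring.zero (A Quot I), add = ring.add (A Quot I),
     smult = (\<lambda>c. coset_map A I (smult A c)),
     nrm = coset_nrm A,
     adj = coset_map A I (adj A)\<rparr>"

text \<open>\<^const>\<open>FactRing\<close> only refers to the operations of the record, so it also yields the additive and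
  the Jordan structure of the quotient of a Lie--Jordan algebra.\<close>

definition lie_jordan_quot ::
  "('a, 'm) lie_jordan_algebra_scheme \<Rightarrow> 'a set \<Rightarrow> 'a set lie_jordan_algebra" where
  "lie_jordan_quot L J =
    \<lparr>carrier = carrier (L Quot J), monoid.mult = monoid.mult (L Quot J), one = monoid.one (L Quot J),
     ring.zero = ring.zero (L Quot J), add = ring.add (L Quot J),
     smult = (\<lambda>r. coset_map L J (smult L r)),
     nrm = coset_nrm L,
     lie = (\<lambda>S T. \<Union>x\<in>S. \<Union>y\<in>T. J +>\<^bsub>L\<^esub> lie L x y)\<rparr>"

end

theory Submission
  imports Defs
begin

text \<open>The quotient norm of \<open>x\<close> is \<open>infdist x D\<close>, so every norm statement about \<open>O / D\<close> is proved
  on representatives.  Averaging a representative with its adjoint does not increase its norm: hence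
  the distances of a self-adjoint element to \<open>D\<close> and to \<open>J\<close> agree, every self-adjoint coset
  contains a self-adjoint element, and \<open>n + J \<mapsto> n + D\<close> is an isometric bijection onto the
  self-adjoint part of \<open>O / D\<close>.

  Two facts need C*-algebra theory, namely the C*-identity of the quotient norm and
  \<open>\<parallel>a\<^sup>2\<parallel> \<le> \<parallel>a\<^sup>2 + b\<^sup>2\<parallel>\<close> for self-adjoint cosets.  Both are obtained without spectral theory: square
  roots and inverses come from Banach's fixed point theorem, and norms are estimated by writing
  self-adjoint elements as real parts of unitaries.\<close>

section \<open>Square roots, inverses and unitaries\<close>

text \<open>The obstacle is that \<open>O / D\<close> is only a record of cosets, to which the facts
  about the type class do not apply. Constructions that would naturally take place in the quotient
  are therefore carried out in the ambient algebra, with equations and commutation holding modulo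
  \<open>D\<close>; a multiple of a unitary of \<open>O / D\<close> appears as an element
  \<open>u\<close> for which \<open>star u * u\<close> differs from a scalar by an element of
  \<open>D\<close>. The inequality for squares is usually read off from the order on positive
  elements. Here positivity of \<open>y\<close> is replaced by the norm condition
  \<open>norm (m *\<^sub>R 1 - y) \<le> m\<close>: it holds for the square of a self-adjoint element
  once \<open>m\<close> exceeds its norm, and the triangle inequality carries it over to sums. This
  is what lets a sum of squares, shifted by an arbitrarily small positive scalar, have a square root
  again.\<close>

lemma star_zero [simp]: "star (0::'a::unital_cstar_algebra) = 0"
  using star_add[of "0::'a" 0] by simp

lemma star_minus [simp]: "star (- x) = - star (x::'a::unital_cstar_algebra)"
  using star_add[of x "- x"] by (simp add: eq_neg_iff_add_eq_0 add.commute)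

lemma star_diff: "star (x - y) = star x - star (y::'a::unital_cstar_algebra)"
  using star_add[of x "- y"] by simp

lemma star_one [simp]: "star (1::'a::unital_cstar_algebra) = 1"
  using star_mult[of "star (1::'a)" 1] by (simp add: star_star)

lemma star_scaleR: "star (r *\<^sub>R x) = r *\<^sub>R star (x::'a::unital_cstar_algebra)"
  by (metis scaleC_of_real star_scaleC complex_cnj_complex_of_real)

lemma scaleC_diff_right: "c *\<^sub>C (x - y) = c *\<^sub>C x - c *\<^sub>C (y::'a::unital_cstar_algebra)"
  by (rule cvec.scale_right_diff_distrib)

lemma scaleC_minus_right: "c *\<^sub>C (- x) = - (c *\<^sub>C (x::'a::unital_cstar_algebra))"
  by (rule cvec.scale_minus_right)

lemma scaleC_minus_left: "(- c) *\<^sub>C x = - (c *\<^sub>C (x::'a::unital_cstar_algebra))"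
  by (rule cvec.scale_minus_left)

lemma scaleC_scaleR: "c *\<^sub>C (r *\<^sub>R x) = r *\<^sub>R (c *\<^sub>C (x::'a::unital_cstar_algebra))"
  by (metis scaleC_of_real scaleC_scaleC mult.commute)

lemma norm_star [simp]: "norm (star x) = norm (x::'a::unital_cstar_algebra)"
proof -
  have le: "norm y \<le> norm (star y)" for y :: 'a
  proof (cases "norm y = 0")
    case False
    have "norm y * norm y \<le> norm (star y) * norm y"
      using cstar_identity[of y] norm_mult_ineq[of "star y" y] by (simp add: power2_eq_square)
    with False show ?thesis by (simp add: mult_le_cancel_right)
  qed simp
  from le[of x] le[of "star x"] show ?thesis by (simp add: star_star)
qed

lemma bounded_linear_star: "bounded_linear (star :: 'a::unital_cstar_algebra \<Rightarrow> 'a)"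
  by (rule bounded_linear_intro[where K = 1]) (simp_all add: star_add star_scaleR)

lemma bounded_linear_scaleC: "bounded_linear (scaleC c :: 'a::unital_cstar_algebra \<Rightarrow> 'a)"
  by (rule bounded_linear_intro[where K = "cmod c"])
    (simp_all add: scaleC_add_right scaleC_scaleR norm_scaleC)

lemmas continuous_on_star [continuous_intros] =
  bounded_linear.continuous_on[OF bounded_linear_star]

text \<open>By the C*-identity the norm of the unit is idempotent. The value 0 belongs to the zero
  algebra, which the class admits, so only the upper bound is available throughout.\<close>

lemma norm_one_le: "norm (1::'a::unital_cstar_algebra) \<le> 1"
proof -
  have "norm (1::'a) * norm (1::'a) = norm (1::'a)"
    using cstar_identity[of "1::'a"] by (simp add: power2_eq_square)
  then have "norm (1::'a) = 0 \<or> norm (1::'a) = 1" by simp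
  then show ?thesis by auto
qed

lemma norm_scaleR_one_le: "0 \<le> r \<Longrightarrow> norm (r *\<^sub>R (1::'a::unital_cstar_algebra)) \<le> r"
  using mult_left_mono[OF norm_one_le, of r] by simp

lemma norm_isometry_le:
  fixes u :: "'a::unital_cstar_algebra"
  assumes "star u * u = 1"
  shows "norm u \<le> 1"
proof -
  have "norm u ^ 2 = norm (1::'a)" using cstar_identity[of u] assms by simp
  then have "norm u ^ 2 \<le> 1\<^sup>2" using norm_one_le[where 'a = 'a] by simp
  then show ?thesis by (rule power2_le_imp_le) simp
qed

section \<open>Real parts and the decomposition into self-adjoint elements\<close>

definition real_part :: "'a::unital_cstar_algebra \<Rightarrow> 'a" where
  "real_part x = (1/2) *\<^sub>R (x + star x)"

lemma star_real_part: "star (real_part x) = real_part x"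
  by (simp add: real_part_def star_scaleR star_add star_star add.commute)

lemma real_part_self_adjoint: "star x = x \<Longrightarrow> real_part x = x"
  by (simp add: real_part_def flip: scaleR_2)

lemma real_part_add: "real_part (x + y) = real_part x + real_part y"
  by (simp add: real_part_def star_add algebra_simps)

lemma real_part_diff: "real_part (x - y) = real_part x - real_part y"
  by (simp add: real_part_def star_diff algebra_simps)

lemma norm_real_part_le: "norm (real_part x) \<le> norm x"
proof -
  have "norm (x + star x) \<le> norm x + norm x" using norm_triangle_ineq[of x "star x"] by simp
  then show ?thesis by (simp add: real_part_def)
qed

lemma star_add_i_mult_self:
  fixes a b :: "'a::unital_cstar_algebra"
  assumes "star a = a" "star b = b"
  shows "star (a + \<i> *\<^sub>C b) * (a + \<i> *\<^sub>C b) = a * a + b * b + \<i> *\<^sub>C (a * b - b * a)"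
  by (simp add: star_add star_scaleC assms algebra_simps mult_scaleC_left mult_scaleC_right
      scaleC_add_right scaleC_diff_right scaleC_scaleC scaleC_minus_left)

lemma real_part_add_i:
  fixes a b :: "'a::unital_cstar_algebra"
  assumes "star a = a" "star b = b"
  shows "real_part (a + \<i> *\<^sub>C b) = a"
  by (simp add: real_part_def star_add star_scaleC assms scaleC_minus_left flip: scaleR_2)

text \<open>The real part of \<open>(- \<i>) *\<^sub>C x\<close> is the imaginary part of
  \<open>x\<close>, which gives the inverse map. The hypotheses are met by the subalgebra and by the
  ideal alike.\<close>

lemma bij_betw_add_i:
  fixes S :: "'a::unital_cstar_algebra set"
  assumes S: "\<And>x c. x \<in> S \<Longrightarrow> c *\<^sub>C x \<in> S" "\<And>x y. \<lbrakk>x \<in> S; y \<in> S\<rbrakk> \<Longrightarrow> x + y \<in> S"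
    "\<And>x. x \<in> S \<Longrightarrow> star x \<in> S"
  shows "bij_betw (\<lambda>(a, b). a + \<i> *\<^sub>C b) (self_adjoint S \<times> self_adjoint S) S"
proof -
  have i: "(- \<i>) *\<^sub>C \<i> *\<^sub>C b = b" for b :: 'a by (simp add: scaleC_scaleC)
  have re: "real_part x \<in> S" if "x \<in> S" for x
    using S(1)[OF S(2)[OF that S(3)[OF that]], of "complex_of_real (1/2)"]
    unfolding real_part_def scaleC_of_real .
  show ?thesis
  proof (rule bij_betw_byWitness[where f' = "\<lambda>x. (real_part x, real_part ((- \<i>) *\<^sub>C x))"])
    show "\<forall>p\<in>self_adjoint S \<times> self_adjoint S.
      (\<lambda>x. (real_part x, real_part ((- \<i>) *\<^sub>C x))) ((\<lambda>(a, b). a + \<i> *\<^sub>C b) p) = p"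
    proof clarify
      fix a b assume "a \<in> self_adjoint S" "b \<in> self_adjoint S"
      then have ab: "star a = a" "star b = b" by (auto simp: self_adjoint_def)
      have "(- \<i>) *\<^sub>C (a + \<i> *\<^sub>C b) = b + \<i> *\<^sub>C (- a)"
        unfolding scaleC_add_right i by (simp add: scaleC_minus_left)
      then show "real_part (a + \<i> *\<^sub>C b) = a \<and> real_part ((- \<i>) *\<^sub>C (a + \<i> *\<^sub>C b)) = b"
        using real_part_add_i[of a b] real_part_add_i[of b "- a"] ab by simp
    qed
    show "\<forall>x\<in>S. (\<lambda>(a, b). a + \<i> *\<^sub>C b) (real_part x, real_part ((- \<i>) *\<^sub>C x)) = x"
    proof
      fix x assume "x \<in> S"
      have "\<i> *\<^sub>C real_part ((- \<i>) *\<^sub>C x) = (1/2) *\<^sub>R (x - star x)"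
        by (simp add: real_part_def scaleC_scaleR star_scaleC scaleC_add_right scaleC_scaleC
            scaleC_minus_left scaleC_diff_right)
      then show "(\<lambda>(a, b). a + \<i> *\<^sub>C b) (real_part x, real_part ((- \<i>) *\<^sub>C x)) = x"
        by (simp add: real_part_def flip: scaleR_add_right scaleR_2)
    qed
    show "(\<lambda>(a, b). a + \<i> *\<^sub>C b) ` (self_adjoint S \<times> self_adjoint S) \<subseteq> S"
      by (auto simp: self_adjoint_def S)
    show "(\<lambda>x. (real_part x, real_part ((- \<i>) *\<^sub>C x))) ` S \<subseteq> self_adjoint S \<times> self_adjoint S"
      unfolding self_adjoint_def
      by (intro image_subsetI SigmaI CollectI conjI re S(1) star_real_part)
  qed
qed

text \<open>The pair \<open>O\<close>, \<open>D\<close> in abstract form. The case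
  \<open>D = {0}\<close> is intended too: there \<open>infdist x D\<close> is \<open>norm x\<close>
  and commutation modulo \<open>D\<close> is commutation, so results about the quotient also yield
  those about the algebra itself.\<close>

locale closed_star_ideal =
  fixes A D :: "'a::unital_cstar_algebra set"
  assumes closed_A: "closed A"
    and one_A: "1 \<in> A"
    and add_A: "\<lbrakk>x \<in> A; y \<in> A\<rbrakk> \<Longrightarrow> x + y \<in> A"
    and mult_A: "\<lbrakk>x \<in> A; y \<in> A\<rbrakk> \<Longrightarrow> x * y \<in> A"
    and scaleC_A: "x \<in> A \<Longrightarrow> c *\<^sub>C x \<in> A"
    and star_A: "x \<in> A \<Longrightarrow> star x \<in> A"
    and D_subset: "D \<subseteq> A"
    and closed_D: "closed D"
    and zero_D: "0 \<in> D"
    and add_D: "\<lbrakk>x \<in> D; y \<in> D\<rbrakk> \<Longrightarrow> x + y \<in> D"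
    and mult_left_D: "\<lbrakk>x \<in> A; d \<in> D\<rbrakk> \<Longrightarrow> x * d \<in> D"
    and mult_right_D: "\<lbrakk>x \<in> A; d \<in> D\<rbrakk> \<Longrightarrow> d * x \<in> D"
    and star_D: "x \<in> D \<Longrightarrow> star x \<in> D"
begin

lemma in_A: "x \<in> D \<Longrightarrow> x \<in> A"
  using D_subset by blast

lemma scaleR_A: "x \<in> A \<Longrightarrow> r *\<^sub>R x \<in> A"
  using scaleC_A[of x "complex_of_real r"] by (simp add: scaleC_of_real)

lemma minus_A: "x \<in> A \<Longrightarrow> - x \<in> A"
  using scaleR_A[of x "- 1"] by simp

lemma zero_A: "0 \<in> A"
  using zero_D in_A by blast

lemma diff_A: "\<lbrakk>x \<in> A; y \<in> A\<rbrakk> \<Longrightarrow> x - y \<in> A"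
  using add_A[of x "- y"] minus_A by simp

lemma scaleC_D: "x \<in> D \<Longrightarrow> c *\<^sub>C x \<in> D"
  using mult_left_D[OF scaleC_A[OF one_A, of c], of x] by (simp add: mult_scaleC_left)

lemma scaleR_D: "x \<in> D \<Longrightarrow> r *\<^sub>R x \<in> D"
  using scaleC_D[of x "complex_of_real r"] by (simp add: scaleC_of_real)

lemma minus_D: "x \<in> D \<Longrightarrow> - x \<in> D"
  using scaleR_D[of x "- 1"] by simp

lemma diff_D: "\<lbrakk>x \<in> D; y \<in> D\<rbrakk> \<Longrightarrow> x - y \<in> D"
  using add_D[of x "- y"] minus_D by simp

lemma real_part_A: "x \<in> A \<Longrightarrow> real_part x \<in> A"
  unfolding real_part_def by (intro scaleR_A add_A star_A)

lemma real_part_D: "x \<in> D \<Longrightarrow> real_part x \<in> D"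
  unfolding real_part_def by (intro scaleR_D add_D star_D)

text \<open>The root is sought as \<open>1 - w\<close>, where \<open>w\<close> is the fixed point of the contraction
  \<open>w \<mapsto> (z + w\<^sup>2) / 2\<close>; every closed condition preserved by that map passes to the root.\<close>

lemma sqrt_exists:
  assumes z: "z \<in> A" "star z = z" "norm z < 1" and a: "a \<in> A" "a * z - z * a \<in> D"
  obtains s where "s \<in> A" "star s = s" "s * s = 1 - z" "a * s - s * a \<in> D"
proof -
  \<comment> \<open>The radius \<open>norm z\<close> makes the ball invariant, because
    \<open>norm (w * w) \<le> norm z\<close> on it, and \<open>norm z\<close> is also the
    contraction factor.\<close>
  define S where "S = cball 0 (norm z) \<inter> (A \<inter> ({w. star w = w} \<inter> (\<lambda>w. a * w - w * a) -` D))"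
  define f where "f w = (1/2) *\<^sub>R (z + w * w)" for w
  have "closed {w::'a. star w = w}"
    by (intro closed_Collect_eq continuous_intros)
  moreover have "closed ((\<lambda>w. a * w - w * a) -` D)"
    by (intro closed_vimage closed_D continuous_intros)
  ultimately have "complete S"
    unfolding S_def complete_eq_closed by (intro closed_Int closed_A closed_cball)
  moreover have "0 \<in> S" by (simp add: S_def zero_A zero_D)
  then have "S \<noteq> {}" by blast
  moreover have "f ` S \<subseteq> S"
  proof clarify
    fix w assume "w \<in> S"
    then have w: "norm w \<le> norm z" "w \<in> A" "star w = w" "a * w - w * a \<in> D"
      by (auto simp: S_def)
    have "norm (w * w) \<le> norm z * 1"
      using w(1) z(3) by (intro order_trans[OF norm_mult_ineq] mult_mono) auto
    then have "norm (f w) \<le> norm z"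
      using norm_triangle_ineq[of z "w * w"] by (simp add: f_def)
    moreover have "f w \<in> A" unfolding f_def by (intro scaleR_A add_A mult_A z w)
    moreover have "star (f w) = f w" by (simp add: f_def star_scaleR star_add star_mult w z)
    \<comment> \<open>The commutator with \<open>a\<close> is a derivation, so that of
      \<open>w * w\<close> lies in the ideal as soon as that of \<open>w\<close> does.\<close>
    moreover have "a * f w - f w * a =
        (1/2) *\<^sub>R ((a * z - z * a) + ((a * w - w * a) * w + w * (a * w - w * a)))"
      by (simp add: f_def algebra_simps)
    then have "a * f w - f w * a \<in> D"
      by (simp add: scaleR_D add_D mult_left_D mult_right_D w a)
    ultimately show "f w \<in> S" by (simp add: S_def)
  qed
  moreover have "dist (f v) (f w) \<le> norm z * dist v w" if "v \<in> S \<and> w \<in> S" for v w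
  proof -
    have vw: "norm v \<le> norm z" "norm w \<le> norm z" using that by (auto simp: S_def)
    have "norm (v * (v - w) + (v - w) * w) \<le> norm v * norm (v - w) + norm (v - w) * norm w"
      by (intro norm_triangle_le add_mono norm_mult_ineq)
    also have "\<dots> \<le> norm z * norm (v - w) + norm (v - w) * norm z"
      by (intro add_mono mult_right_mono mult_left_mono vw) auto
    finally have "norm (v * (v - w) + (v - w) * w) \<le> 2 * (norm z * norm (v - w))" by simp
    moreover have "f v - f w = (1/2) *\<^sub>R (v * (v - w) + (v - w) * w)"
      by (simp add: f_def algebra_simps)
    ultimately show ?thesis by (simp add: dist_norm)
  qed
  ultimately have "\<exists>!w\<in>S. f w = w"
    by (intro Banach_fix[of S "norm z"]) (auto simp: z)
  then obtain w where w: "w \<in> S" "f w = w" by blast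
  have "2 *\<^sub>R w = z + w * w" using arg_cong[OF w(2), of "(*\<^sub>R) 2"] by (simp add: f_def)
  then have "(1 - w) * (1 - w) = 1 - z" by (simp add: algebra_simps scaleR_2)
  moreover have "a * (1 - w) - (1 - w) * a = - (a * w - w * a)" by (simp add: algebra_simps)
  ultimately show thesis
    using that[of "1 - w"] w(1) minus_D[of "a * w - w * a"]
    by (simp add: S_def star_diff diff_A one_A)
qed

end

lemma closed_star_ideal_zero: "closed_star_ideal UNIV {0::'a::unital_cstar_algebra}"
  by unfold_locales auto

text \<open>If \<open>s\<^sup>2 = 1 - a\<^sup>2\<close> commutes with \<open>a\<close>, then \<open>a + \<i> s\<close> is unitary.\<close>

lemma norm_one_minus_square_le:
  fixes a :: "'a::unital_cstar_algebra"
  assumes a: "star a = a" "norm (a * a) < 1"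
  shows "norm (1 - a * a) \<le> 1"
proof -
  interpret closed_star_ideal UNIV "{0::'a}" by (rule closed_star_ideal_zero)
  obtain s where s: "star s = s" "s * s = 1 - a * a" "a * s = s * a"
    using sqrt_exists[of "a * a" a] a by (auto simp: star_mult mult.assoc)
  \<comment> \<open>The two parts are exchanged, so that the real part is \<open>s\<close>, whose
    square is the element to be estimated.\<close>
  have st: "star (s + \<i> *\<^sub>C a) * (s + \<i> *\<^sub>C a) = 1"
    using star_add_i_mult_self[of s a] s a by simp
  have "norm s \<le> norm (s + \<i> *\<^sub>C a)"
    using norm_real_part_le[of "s + \<i> *\<^sub>C a"] real_part_add_i[of s a] s a by simp
  also have "\<dots> \<le> 1" by (rule norm_isometry_le[OF st])
  finally have "norm s ^ 2 \<le> 1" by (simp add: power_le_one)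
  then show ?thesis using cstar_identity[of s] s by simp
qed

text \<open>Rescaling by \<open>1 / sqrt r\<close> reduces this to radius 1. It expresses positivity
  of \<open>a * a\<close> as a norm bound, a form that can be added over several squares.\<close>

lemma norm_minus_square_le:
  fixes a :: "'a::unital_cstar_algebra"
  assumes a: "star a = a" "norm (a * a) < r"
  shows "norm (r *\<^sub>R 1 - a * a) \<le> r"
proof -
  have r: "r > 0" using a(2) norm_ge_zero[of "a * a"] by linarith
  define b where "b = (1 / sqrt r) *\<^sub>R a"
  have bb: "b * b = (1 / r) *\<^sub>R (a * a)" using r by (simp add: b_def)
  have "norm (1 - b * b) \<le> 1"
    using a r by (intro norm_one_minus_square_le) (simp_all add: bb b_def star_scaleR)
  moreover have "r *\<^sub>R 1 - a * a = r *\<^sub>R (1 - b * b)"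
    using r by (simp add: bb algebra_simps)
  ultimately show ?thesis using r by (simp add: mult_left_le)
qed

context closed_star_ideal
begin

text \<open>For \<open>r\<close> above \<open>norm (w * w)\<close>, the element
  \<open>1 + w * w\<close> is \<open>(1 + r) *\<^sub>R (1 - z)\<close> with
  \<open>norm z \<le> r / (1 + r) < 1\<close>. The inverse of \<open>1 - z\<close> is the fixed
  point of \<open>h \<mapsto> 1 + z * h\<close>, a Neumann series in disguise; iterating inside
  \<open>S\<close> keeps it in \<open>A\<close>, self-adjoint and commuting with
  \<open>w\<close>.\<close>

lemma inverse_one_plus_square_exists:
  assumes w: "w \<in> A" "star w = w"
  obtains g where "g \<in> A" "star g = g" "g * w = w * g" "(1 + w * w) * g = 1"
proof -
  define r where "r = norm (w * w) + 1"
  define z where "z = (1 / (1 + r)) *\<^sub>R (r *\<^sub>R 1 - w * w)"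
  have r: "r > 0" "norm (w * w) < r" by (simp_all add: r_def add_nonneg_pos)
  have "norm z \<le> r / (1 + r)"
    using norm_minus_square_le[OF w(2) r(2)] r by (simp add: z_def divide_simps)
  also have "\<dots> < 1" using r by simp
  finally have z1: "norm z < 1" .
  have zA: "z \<in> A" unfolding z_def by (intro scaleR_A diff_A one_A mult_A w)
  have zs: "star z = z" by (simp add: z_def star_scaleR star_diff star_mult w)
  \<comment> \<open>Commutation with \<open>w\<close> passes to \<open>z\<close>, and it is what
    makes \<open>z * h\<close> self-adjoint.\<close>
  have zw: "h * z = z * h" if "h * w = w * h" for h
  proof -
    have "h * (w * w) = (w * w) * h" by (metis that mult.assoc)
    then show ?thesis by (simp add: z_def algebra_simps)
  qed
  define S where "S = A \<inter> ({h. star h = h} \<inter> {h. h * w = w * h})"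
  define f where "f h = 1 + z * h" for h
  have "complete S" unfolding S_def complete_eq_closed
    by (intro closed_Int closed_A closed_Collect_eq continuous_intros)
  moreover have "0 \<in> S" by (simp add: S_def zero_A)
  then have "S \<noteq> {}" by blast
  moreover have "f ` S \<subseteq> S"
  proof clarify
    fix h assume "h \<in> S"
    then have h: "h \<in> A" "star h = h" "h * w = w * h" by (auto simp: S_def)
    have "z * h * w = w * (z * h)" using h(3) zw[of w] by (metis mult.assoc)
    then show "f h \<in> S" using zw[OF h(3)]
      by (simp add: S_def f_def add_A one_A mult_A zA h star_add star_mult zs algebra_simps)
  qed
  moreover have "dist (f v) (f h) \<le> norm z * dist v h" for v h
    using norm_mult_ineq[of z "v - h"] by (simp add: dist_norm f_def algebra_simps)
  ultimately have "\<exists>!h\<in>S. f h = h"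
    by (intro Banach_fix[of S "norm z"]) (auto simp: z1)
  then obtain h where h: "h \<in> S" "f h = h" by blast
  have "(1 + r) *\<^sub>R z = r *\<^sub>R 1 - w * w" using r by (simp add: z_def)
  then have "1 + w * w = (1 + r) *\<^sub>R (1 - z)" by (simp add: algebra_simps)
  then have "(1 + w * w) * ((1 / (1 + r)) *\<^sub>R h) = (1 - z) * h" using r by simp
  also have "\<dots> = 1" using h(2) by (simp add: f_def left_diff_distrib diff_eq_eq)
  finally show thesis
    using that[of "(1 / (1 + r)) *\<^sub>R h"] h(1)
    by (simp add: S_def star_scaleR scaleR_A)
qed

end

text \<open>The Cayley transform \<open>(1 + \<i> w) / (1 - \<i> w) = (1 + \<i> w)\<^sup>2 g\<close> is unitary, with real part
  \<open>2 g - 1\<close> and imaginary part \<open>2 w g\<close>.\<close>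

lemma norm_inverse_one_plus_square:
  fixes w g :: "'a::unital_cstar_algebra"
  assumes w: "star w = w" and g: "star g = g" "g * w = w * g" "(1 + w * w) * g = 1"
  shows "norm g \<le> 1" and "norm (w * g) \<le> 1/2"
proof -
  define c where "c = 2 *\<^sub>R g - 1"
  define s where "s = 2 *\<^sub>R (w * g)"
  have wwg: "w * (w * g) = 1 - g" using g(3) by (simp add: algebra_simps)
  have gwg: "g * (w * x) = w * (g * x)" for x using g(2) by (metis mult.assoc)
  have wwgg: "w * (w * (g * g)) = g - g * g"
    using arg_cong[OF wwg, of "\<lambda>x. x * g"] by (simp add: algebra_simps)
  have c: "star c = c" by (simp add: c_def star_diff star_scaleR g)
  have s: "star s = s" by (simp add: s_def star_scaleR star_mult w g)
  have sc: "c * s - s * c = 0" by (simp add: c_def s_def algebra_simps gwg)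
  have "c * c + s * s = 1"
    by (simp add: c_def s_def algebra_simps gwg wwgg flip: scaleR_2)
  \<comment> \<open>Exchanging \<open>c\<close> and \<open>s\<close> exhibits each of them as the
    real part of an isometry, which yields both bounds.\<close>
  with sc have 1: "star (c + \<i> *\<^sub>C s) * (c + \<i> *\<^sub>C s) = 1"
      "star (s + \<i> *\<^sub>C c) * (s + \<i> *\<^sub>C c) = 1"
    using star_add_i_mult_self[OF c s] star_add_i_mult_self[OF s c] by (simp_all add: add.commute)
  have "norm c \<le> 1"
    using norm_real_part_le[of "c + \<i> *\<^sub>C s"] norm_isometry_le[OF 1(1)]
      real_part_add_i[OF c s] by simp
  moreover have "norm (2 *\<^sub>R g) \<le> norm c + norm (1::'a)"
    using norm_triangle_ineq[of c 1] by (simp add: c_def)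
  ultimately show "norm g \<le> 1" using norm_one_le[where 'a = 'a] by simp
  have "norm s \<le> 1"
    using norm_real_part_le[of "s + \<i> *\<^sub>C c"] norm_isometry_le[OF 1(2)]
      real_part_add_i[OF s c] by simp
  then show "norm (w * g) \<le> 1/2" by (simp add: s_def)
qed

section \<open>The quotient norm\<close>

text \<open>Serves distances that need not be attained: a bound proved for every \<open>r\<close>
  above the infimum passes to the infimum. The case \<open>k = 0\<close> is separate because the
  argument divides by \<open>k\<close>.\<close>

lemma le_mult_dense:
  fixes a c k :: real
  assumes "0 \<le> k" and le: "\<And>r. a < r \<Longrightarrow> c \<le> r * k"
  shows "c \<le> a * k"
proof (cases "k = 0")
  case True
  then show ?thesis using le[of "a + 1"] by simp
next
  case False
  with assms(1) have k: "k > 0" by simp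
  have "c / k \<le> a"
  proof (rule dense_ge)
    fix r assume "a < r"
    then show "c / k \<le> r" using le[of r] k by (simp add: pos_divide_le_eq)
  qed
  with k show ?thesis by (simp add: pos_divide_le_eq)
qed

context closed_star_ideal
begin

lemma infdist_D_le: "d \<in> D \<Longrightarrow> infdist x D \<le> norm (x + d)"
  using infdist_le[of "- d" D x] minus_D by (simp add: dist_norm)

lemma infdist_D_less:
  assumes "infdist x D < r"
  obtains d where "d \<in> D" "norm (x + d) < r"
proof -
  have "D \<noteq> {}" using zero_D by blast
  then obtain d where "d \<in> D" "dist x d < r"
    using assms by (auto simp: infdist_notempty cINF_less_iff)
  then show thesis using that[of "- d"] minus_D by (simp add: dist_norm)
qed

lemma infdist_D_less_self_adjoint:
  assumes "star x = x" "infdist x D < r"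
  obtains d where "d \<in> D" "star d = d" "norm (x + d) < r"
proof -
  obtain d where d: "d \<in> D" "norm (x + d) < r" using infdist_D_less assms(2) by blast
  have "norm (x + real_part d) \<le> norm (x + d)"
    using norm_real_part_le[of "x + d"] by (simp add: real_part_add real_part_self_adjoint assms)
  with d show thesis using that[of "real_part d"] by (simp add: real_part_D star_real_part)
qed

lemma infdist_D_le_cong:
  assumes "x - y \<in> D"
  shows "infdist x D \<le> infdist y D"
proof (rule dense_ge)
  fix r assume "infdist y D < r"
  then obtain d where d: "d \<in> D" "norm (y + d) < r" by (rule infdist_D_less)
  have "infdist x D \<le> norm (x + (d - (x - y)))" by (rule infdist_D_le[OF diff_D[OF d(1) assms]])
  with d(2) show "infdist x D \<le> r" by (simp add: add.commute)
qed

lemma infdist_D_cong: "x - y \<in> D \<Longrightarrow> infdist x D = infdist y D"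
  using infdist_D_le_cong[of x y] infdist_D_le_cong[of y x] minus_D[of "x - y"] by simp

lemma infdist_D_le_norm: "infdist x D \<le> norm x"
  using infdist_D_le[OF zero_D, of x] by simp

lemma infdist_D_eq_0_iff: "infdist x D = 0 \<longleftrightarrow> x \<in> D"
proof -
  have "D \<noteq> {}" using zero_D by blast
  then show ?thesis using in_closed_iff_infdist_zero[OF closed_D, of x] by blast
qed

lemma infdist_D_add: "infdist (x + y) D \<le> infdist x D + infdist y D"
proof -
  have le: "infdist (x + y) D \<le> r + s" if x: "infdist x D < r" and y: "infdist y D < s" for r s
  proof -
    obtain d where d: "d \<in> D" "norm (x + d) < r" using x by (rule infdist_D_less)
    obtain e where e: "e \<in> D" "norm (y + e) < s" using y by (rule infdist_D_less)
    have "infdist (x + y) D \<le> norm ((x + d) + (y + e))"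
      using infdist_D_le[OF add_D[OF d(1) e(1)], of "x + y"] by (simp add: algebra_simps)
    also have "\<dots> \<le> norm (x + d) + norm (y + e)" by (rule norm_triangle_ineq)
    finally show ?thesis using d e by simp
  qed
  have "infdist (x + y) D - infdist x D \<le> infdist y D"
  proof (rule dense_ge)
    fix s assume s: "infdist y D < s"
    have "infdist (x + y) D - s \<le> infdist x D"
    proof (rule dense_ge)
      fix r assume "infdist x D < r"
      from le[OF this s] show "infdist (x + y) D - s \<le> r" by linarith
    qed
    then show "infdist (x + y) D - infdist x D \<le> s" by linarith
  qed
  then show ?thesis by linarith
qed

lemma infdist_D_scaleC: "infdist (c *\<^sub>C x) D = cmod c * infdist x D"
proof -
  have le: "infdist (c *\<^sub>C x) D \<le> cmod c * infdist x D" for c x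
  proof -
    have "infdist (c *\<^sub>C x) D \<le> infdist x D * cmod c"
    proof (rule le_mult_dense)
      fix r assume "infdist x D < r"
      then obtain d where d: "d \<in> D" "norm (x + d) < r" by (rule infdist_D_less)
      have "infdist (c *\<^sub>C x) D \<le> norm (x + d) * cmod c"
        using infdist_D_le[OF scaleC_D[OF d(1), of c], of "c *\<^sub>C x"]
        by (simp add: norm_scaleC mult.commute flip: scaleC_add_right)
      also have "\<dots> \<le> r * cmod c" using d by (intro mult_right_mono) auto
      finally show "infdist (c *\<^sub>C x) D \<le> r * cmod c" .
    qed simp
    then show ?thesis by (simp add: mult.commute)
  qed
  show ?thesis
  proof (cases "c = 0")
    case True
    then show ?thesis by (simp add: zero_D)
  next
    case False
    \<comment> \<open>The reverse inequality is the one just proved, applied to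
      \<open>inverse c\<close> and \<open>c *\<^sub>C x\<close>.\<close>
    have "cmod c * infdist x D = cmod c * infdist (inverse c *\<^sub>C c *\<^sub>C x) D"
      using False by (simp add: scaleC_scaleC)
    also have "\<dots> \<le> cmod c * (cmod (inverse c) * infdist (c *\<^sub>C x) D)"
      by (intro mult_left_mono le) simp
    also have "\<dots> = infdist (c *\<^sub>C x) D" using False by (simp add: norm_inverse)
    finally show ?thesis using le[of c x] by simp
  qed
qed

lemma infdist_D_scaleR: "infdist (r *\<^sub>R x) D = \<bar>r\<bar> * infdist x D"
  using infdist_D_scaleC[of "complex_of_real r" x] by (simp add: scaleC_of_real)

lemma infdist_D_diff: "infdist (x - y) D \<le> infdist x D + infdist y D"
  using infdist_D_add[of x "- y"] infdist_D_scaleR[of "- 1" y] by simp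

lemma infdist_D_star: "infdist (star x) D = infdist x D"
proof -
  have le: "infdist (star x) D \<le> infdist x D" for x
  proof (rule dense_ge)
    fix r assume "infdist x D < r"
    then obtain d where d: "d \<in> D" "norm (x + d) < r" by (rule infdist_D_less)
    have "infdist (star x) D \<le> norm (star (x + d))"
      using infdist_D_le[OF star_D[OF d(1)], of "star x"] by (simp add: star_add)
    with d show "infdist (star x) D \<le> r" by simp
  qed
  show ?thesis using le[of x] le[of "star x"] by (simp add: star_star)
qed

lemma infdist_D_real_part_le: "infdist (real_part x) D \<le> infdist x D"
proof -
  have "infdist (x + star x) D \<le> infdist x D + infdist x D"
    using infdist_D_add[of x "star x"] by (simp add: infdist_D_star)
  then show ?thesis by (simp add: real_part_def infdist_D_scaleR)
qed

lemma infdist_D_mult: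
  assumes "x \<in> A" "y \<in> A"
  shows "infdist (x * y) D \<le> infdist x D * infdist y D"
proof (rule le_mult_dense)
  fix r assume r: "infdist x D < r"
  then obtain d where d: "d \<in> D" "norm (x + d) < r" by (rule infdist_D_less)
  have r0: "0 \<le> r" using r infdist_nonneg[of x D] by linarith
  have "infdist (x * y) D \<le> infdist y D * r"
  proof (rule le_mult_dense[OF r0])
    fix s assume "infdist y D < s"
    then obtain e where e: "e \<in> D" "norm (y + e) < s" by (rule infdist_D_less)
    have "x * e + d * y + d * e \<in> D"
      by (intro add_D mult_left_D mult_right_D d e assms) (rule in_A[OF d(1)])
    then have "infdist (x * y) D \<le> norm ((x + d) * (y + e))"
      using infdist_D_le[of "x * e + d * y + d * e" "x * y"] by (simp add: algebra_simps)
    also have "\<dots> \<le> norm (x + d) * norm (y + e)" by (rule norm_mult_ineq)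
    also have "\<dots> \<le> r * s" using d e r0 by (intro mult_mono) auto
    finally show "infdist (x * y) D \<le> s * r" by (simp add: mult.commute)
  qed
  then show "infdist (x * y) D \<le> r * infdist y D" by (simp add: mult.commute)
qed (rule infdist_nonneg)

text \<open>Given \<open>x\<^sup>*x + d\<close> of norm less than \<open>r\<close>, the element \<open>g = (1 + k\<^sup>2d\<^sup>2)\<^sup>-\<^sup>1\<close> plays the role of
  \<open>1 - u\<close> for an approximate unit \<open>u\<close> of \<open>D\<close>: it is \<open>1\<close> modulo \<open>D\<close>, a contraction, and
  \<open>d g\<close> has norm at most \<open>1 / (2k)\<close>, so that \<open>g x\<^sup>*x g\<close> has norm at most \<open>r + 1 / (2k)\<close>.\<close>

lemma infdist_D_star_mult_ge:
  assumes x: "x \<in> A"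
  shows "infdist x D ^ 2 \<le> infdist (star x * x) D"
proof (rule dense_ge)
  fix r assume r: "infdist (star x * x) D < r"
  have "star (star x * x) = star x * x" by (simp add: star_mult star_star)
  then obtain d where d: "d \<in> D" "star d = d" "norm (star x * x + d) < r"
    using infdist_D_less_self_adjoint r by blast
  show "infdist x D ^ 2 \<le> r"
  proof (rule field_le_epsilon)
    fix e :: real assume e: "e > 0"
    \<comment> \<open>This is the choice \<open>k = 1 / (2 * e)\<close>: the bound
      \<open>1/2\<close> on \<open>w * g\<close> turns into the bound \<open>e\<close> on
      \<open>d * g\<close>.\<close>
    define w where "w = (1 / (2 * e)) *\<^sub>R d"
    have w: "w \<in> D" "star w = w" by (simp_all add: w_def scaleR_D star_scaleR d)
    obtain g where g: "g \<in> A" "star g = g" "g * w = w * g" "(1 + w * w) * g = 1"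
      using inverse_one_plus_square_exists[OF in_A[OF w(1)] w(2)] by blast
    note ng = norm_inverse_one_plus_square[OF w(2) g(2-4)]
    \<comment> \<open>Thus \<open>g\<close> is \<open>1\<close> modulo \<open>D\<close>, so
      \<open>x * g\<close> represents the coset of \<open>x\<close> and its norm bounds the distance
      from above.\<close>
    have "1 - (w * w) * g = g" using g(4) by (simp add: algebra_simps)
    then have "x * g = x * (1 - (w * w) * g)" by simp
    then have "x * g = x + - (x * ((w * w) * g))" by (simp add: right_diff_distrib)
    moreover have "- (x * ((w * w) * g)) \<in> D"
      by (intro minus_D mult_left_D[OF x] mult_right_D[OF g(1)] mult_left_D[OF in_A] w)
    ultimately have "infdist x D \<le> norm (x * g)" using infdist_D_le by metis
    then have "infdist x D ^ 2 \<le> norm (x * g) ^ 2" by (intro power_mono infdist_nonneg)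
    also have "\<dots> = norm (g * (star x * x) * g)"
      using cstar_identity[of "x * g"] by (simp add: star_mult g mult.assoc)
    also have "g * (star x * x) * g = g * (star x * x + d) * g - g * (d * g)"
      by (simp add: algebra_simps)
    also have "norm \<dots> \<le> norm (g * (star x * x + d) * g) + norm (g * (d * g))"
      by (rule norm_triangle_ineq4)
    also have "\<dots> \<le> r + e"
    proof (rule add_mono)
      have "norm (g * (star x * x + d)) \<le> 1 * r"
        using ng(1) d(3) by (intro order_trans[OF norm_mult_ineq] mult_mono) auto
      then have "norm (g * (star x * x + d) * g) \<le> (1 * r) * 1"
        using ng(1) d(3) order_trans[OF infdist_nonneg less_imp_le[OF r]]
        by (intro order_trans[OF norm_mult_ineq] mult_mono) auto
      then show "norm (g * (star x * x + d) * g) \<le> r" by simp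
      have "d * g = (2 * e) *\<^sub>R (w * g)" using e by (simp add: w_def)
      then have "norm (d * g) \<le> e" using ng(2) e by (simp add: mult.commute)
      then have "norm g * norm (d * g) \<le> 1 * e"
        using ng(1) by (intro mult_mono) auto
      then have "norm (g * (d * g)) \<le> 1 * e" by (rule order_trans[OF norm_mult_ineq])
      then show "norm (g * (d * g)) \<le> e" by simp
    qed
    finally show "infdist x D ^ 2 \<le> r + e" .
  qed
qed

lemma infdist_D_star_mult:
  assumes "x \<in> A"
  shows "infdist (star x * x) D = infdist x D ^ 2"
  using infdist_D_mult[OF star_A[OF assms] assms] infdist_D_star_mult_ge[OF assms]
  by (simp add: infdist_D_star power2_eq_square)

text \<open>Lift to \<open>\<parallel>a\<^sup>2 + b\<^sup>2 + d\<parallel> < r\<close> and choose \<open>s\<^sup>2 = r - (a\<^sup>2 + b\<^sup>2 + d)\<close>. A root \<open>p\<close> of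
  \<open>b\<^sup>2 + s\<^sup>2 + e\<close> that commutes with \<open>a\<close> modulo \<open>D\<close> makes \<open>a + \<i> p\<close> a multiple of a unitary
  modulo \<open>D\<close>.\<close>

lemma infdist_D_square_le_square_add:
  assumes a: "a \<in> A" "star a = a" and b: "b \<in> A" "star b = b"
  shows "infdist (a * a) D \<le> infdist (a * a + b * b) D"
proof (rule dense_ge)
  fix r assume r: "infdist (a * a + b * b) D < r"
  have r0: "r > 0" using r infdist_nonneg[of "a * a + b * b" D] by linarith
  have "star (a * a + b * b) = a * a + b * b" by (simp add: star_add star_mult a b)
  then obtain d where d: "d \<in> D" "star d = d" "norm (a * a + b * b + d) < r"
    using infdist_D_less_self_adjoint r by blast
  define z where "z = (1 / r) *\<^sub>R (a * a + b * b + d)"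
  have zA: "z \<in> A" unfolding z_def by (intro scaleR_A add_A mult_A a b in_A[OF d(1)])
  have zs: "star z = z" by (simp add: z_def star_scaleR star_add star_mult a b d)
  have zn: "norm z < 1" using d(3) r0 by (simp add: z_def)
  obtain s where s: "s \<in> A" "star s = s" "s * s = 1 - z"
    using sqrt_exists[OF zA zs zn one_A] by (auto simp: zero_D)
  define t where "t = sqrt r *\<^sub>R s"
  have t: "star t = t" by (simp add: t_def star_scaleR s)
  have "t * t = r *\<^sub>R (1 - z)" using r0 s(3) by (simp add: t_def)
  then have tt: "t * t = r *\<^sub>R 1 - (a * a + b * b + d)" using r0 by (simp add: z_def algebra_simps)
  define y where "y = b * b + t * t"
  \<comment> \<open>The choice of \<open>t\<close> makes \<open>y\<close> a scalar minus
    \<open>a * a\<close> up to an element of \<open>D\<close>. Hence \<open>y\<close> commutes with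
    \<open>a\<close> modulo \<open>D\<close>, although its two summands need not.\<close>
  have y: "y = r *\<^sub>R 1 - (a * a + d)" by (simp add: y_def tt algebra_simps)
  \<comment> \<open>The added \<open>1\<close> provides the strict inequality that
    \<open>norm_minus_square_le\<close> asks of its radius. Summing the two bounds gives the
    substitute for positivity of \<open>y\<close>.\<close>
  define m1 where "m1 = norm (b * b) + 1"
  define m2 where "m2 = norm (t * t) + 1"
  define m where "m = m1 + m2"
  have m: "m > 0" unfolding m_def m1_def m2_def by (intro add_pos_pos add_nonneg_pos) auto
  have "norm ((m1 *\<^sub>R 1 - b * b) + (m2 *\<^sub>R 1 - t * t)) \<le> m"
    unfolding m_def
    by (intro norm_triangle_mono norm_minus_square_le b t) (auto simp: m1_def m2_def)
  then have my: "norm (m *\<^sub>R 1 - y) \<le> m" by (simp add: m_def y_def algebra_simps)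
  have qa: "infdist a D ^ 2 \<le> r + e" if e: "e > 0" for e
  proof -
    \<comment> \<open>The margin \<open>e\<close> gives \<open>norm v \<le> m / (m + e) < 1\<close>,
      and \<open>(m + e) *\<^sub>R (1 - v)\<close> equals \<open>y + e *\<^sub>R 1\<close>. So
      \<open>l\<close> below is a square root of \<open>y + e *\<^sub>R 1\<close>.\<close>
    define v where "v = (1 / (m + e)) *\<^sub>R (m *\<^sub>R 1 - y)"
    have vA: "v \<in> A" unfolding v_def y
      by (intro scaleR_A diff_A add_A mult_A a one_A in_A[OF d(1)])
    have vs: "star v = v" by (simp add: v_def y star_scaleR star_diff star_add star_mult a d)
    have vn: "norm v < 1" using my m e by (simp add: v_def divide_simps)
    have "a * v - v * a = (1 / (m + e)) *\<^sub>R (a * d - d * a)"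
      by (simp add: v_def y algebra_simps)
    then have "a * v - v * a \<in> D"
      by (simp add: scaleR_D diff_D mult_left_D mult_right_D a d)
    then obtain p where p: "p \<in> A" "star p = p" "p * p = 1 - v" "a * p - p * a \<in> D"
      using sqrt_exists[OF vA vs vn a(1)] by blast
    define l where "l = sqrt (m + e) *\<^sub>R p"
    have l: "l \<in> A" "star l = l" by (simp_all add: l_def star_scaleR p scaleR_A)
    have al: "a * l - l * a \<in> D"
      using scaleR_D[OF p(4), of "sqrt (m + e)"] by (simp add: l_def scaleR_diff_right)
    have mv: "(m + e) *\<^sub>R v = m *\<^sub>R 1 - y" using m e by (simp add: v_def)
    have "l * l = (m + e) *\<^sub>R (1 - v)" using m e p(3) by (simp add: l_def)
    then have ll: "l * l = (r + e) *\<^sub>R 1 - (a * a + d)"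
      unfolding scaleR_diff_right mv by (simp add: y algebra_simps)
    define u where "u = a + \<i> *\<^sub>C l"
    have uA: "u \<in> A" unfolding u_def by (intro add_A scaleC_A a l)
    \<comment> \<open>The squares of \<open>a\<close> and \<open>l\<close> add up to a scalar minus
      \<open>d\<close>; the remaining commutator lies in \<open>D\<close> as well.\<close>
    have "star u * u = (r + e) *\<^sub>R 1 - d + \<i> *\<^sub>C (a * l - l * a)"
      using star_add_i_mult_self[OF a(2) l(2)] by (simp add: u_def ll)
    then have "star u * u - (r + e) *\<^sub>R 1 = \<i> *\<^sub>C (a * l - l * a) - d" by simp
    then have "star u * u - (r + e) *\<^sub>R 1 \<in> D" by (simp add: diff_D scaleC_D al d)
    then have "infdist (star u * u) D = infdist ((r + e) *\<^sub>R 1) D" by (rule infdist_D_cong)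
    also have "\<dots> \<le> r + e"
      using infdist_D_le_norm norm_scaleR_one_le r0 e by (meson order_trans add_nonneg_nonneg less_imp_le)
    finally have "infdist u D ^ 2 \<le> r + e" by (simp add: infdist_D_star_mult uA)
    moreover have "infdist a D \<le> infdist u D"
      using infdist_D_real_part_le[of u] real_part_add_i[OF a(2) l(2)] by (simp add: u_def)
    then have "infdist a D ^ 2 \<le> infdist u D ^ 2" by (intro power_mono infdist_nonneg)
    ultimately show ?thesis by linarith
  qed
  have "infdist a D ^ 2 \<le> r" using qa by (rule field_le_epsilon)
  then show "infdist (a * a) D \<le> r" using infdist_D_star_mult[OF a(1)] a(2) by simp
qed

text \<open>A rapidly converging subsequence is lifted: each consecutive difference is corrected by
  some \<open>d k\<close> in \<open>D\<close> until its norm is below \<open>(1/2) ^ k\<close>. The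
  corrected series converges in the ambient Banach space, and the accumulated corrections stay in
  \<open>D\<close>.\<close>

lemma infdist_D_complete:
  fixes s :: "nat \<Rightarrow> 'a"
  assumes s: "\<And>n. s n \<in> A"
    and Cauchy: "\<And>e. 0 < e \<Longrightarrow> \<exists>M. \<forall>m\<ge>M. \<forall>n\<ge>M. infdist (s m - s n) D < e"
  obtains x where "x \<in> A" "(\<lambda>n. infdist (s n - x) D) \<longlonglongrightarrow> 0"
proof -
  have "\<forall>k. \<exists>M. \<forall>m\<ge>M. \<forall>n\<ge>M. infdist (s m - s n) D < (1/2) ^ k" 
    by (intro allI Cauchy) simp
  then obtain M where "\<forall>k. \<forall>m\<ge>M k. \<forall>n\<ge>M k. infdist (s m - s n) D < (1/2) ^ k"
    by (rule choice[THEN exE])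
  then have M: "\<And>k m n. \<lbrakk>m \<ge> M k; n \<ge> M k\<rbrakk> \<Longrightarrow> infdist (s m - s n) D < (1/2) ^ k" by blast
  \<comment> \<open>The sum over \<open>M\<close> replaces a monotone modulus, so that
    \<open>r k\<close> and \<open>r (Suc k)\<close> both reach \<open>M k\<close>; the summand
    \<open>k\<close> makes the indices unbounded.\<close>
  define r where "r k = k + (\<Sum>i\<le>k. M i)" for k
  have r1: "r k \<ge> M k" "r (Suc k) \<ge> M k" "r k \<ge> k" for k
  proof -
    have "M k \<le> (\<Sum>i\<le>k. M i)" by (rule member_le_sum) auto
    then show "r k \<ge> M k" "r (Suc k) \<ge> M k" "r k \<ge> k" by (simp_all add: r_def)
  qed
  have "\<exists>d\<in>D. norm (s (r (Suc k)) - s (r k) + d) < (1/2) ^ k" for k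
    using infdist_D_less[OF M[OF r1(2,1)]] by blast
  then obtain d where d: "\<And>k. d k \<in> D" "\<And>k. norm (s (r (Suc k)) - s (r k) + d k) < (1/2) ^ k"
    by metis
  define y where "y k = s (r (Suc k)) - s (r k) + d k" for k
  have "summable y"
    by (rule summable_comparison_test'[of "\<lambda>k. (1/2) ^ k" 0]) (simp_all add: y_def d less_imp_le)
  then have lim: "(\<lambda>n. s (r 0) + (\<Sum>k<n. y k)) \<longlonglongrightarrow> s (r 0) + suminf y"
    by (intro tendsto_intros summable_LIMSEQ)
  define x where "x = s (r 0) + suminf y"
  \<comment> \<open>After telescoping, the partial sums are representatives of the cosets of
    \<open>s (r n)\<close>.\<close>
  have partial: "s (r 0) + (\<Sum>k<n. y k) = s (r n) + (\<Sum>k<n. d k)" for n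
  proof (induction n)
    case (Suc n)
    have "s (r 0) + (\<Sum>k<Suc n. y k) = (s (r 0) + (\<Sum>k<n. y k)) + y n" by (simp add: add.assoc)
    also have "\<dots> = s (r (Suc n)) + (\<Sum>k<Suc n. d k)"
      unfolding Suc.IH by (simp add: y_def)
    finally show ?case .
  qed simp
  have dD: "(\<Sum>k<n. d k) \<in> D" for n
    by (induction n) (simp_all add: zero_D add_D d)
  have "x \<in> A" unfolding x_def
    by (rule closed_sequentially[OF closed_A _ lim]) (simp add: partial add_A s in_A[OF dD])
  have "(\<lambda>n. infdist (s n - x) D) \<longlonglongrightarrow> 0"
  proof (rule LIMSEQ_I)
    fix e :: real assume e: "e > 0"
    obtain N where N: "\<And>m n. \<lbrakk>m \<ge> N; n \<ge> N\<rbrakk> \<Longrightarrow> infdist (s m - s n) D < e / 2"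
      using Cauchy[of "e / 2"] e by auto
    obtain K where K: "\<And>n. n \<ge> K \<Longrightarrow> norm (s (r 0) + (\<Sum>k<n. y k) - x) < e / 2"
      using LIMSEQ_D[OF lim, of "e / 2"] e by (auto simp: x_def)
    define j where "j = max N K"
    have "infdist (s (r j) - x) D \<le> norm (s (r j) - x + (\<Sum>k<j. d k))"
      by (rule infdist_D_le[OF dD])
    also have "s (r j) - x + (\<Sum>k<j. d k) = s (r 0) + (\<Sum>k<j. y k) - x"
      by (simp add: partial)
    also have "norm \<dots> < e / 2" by (rule K) (simp add: j_def)
    finally have 1: "infdist (s (r j) - x) D < e / 2" .
    have "infdist (s n - x) D < e" if "n \<ge> N" for n
    proof -
      have "infdist (s n - s (r j)) D < e / 2"
        using r1(3)[of j] by (intro N that) (simp add: j_def)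
      with 1 infdist_D_add[of "s n - s (r j)" "s (r j) - x"] show ?thesis by simp
    qed
    then show "\<exists>N. \<forall>n\<ge>N. norm (infdist (s n - x) D - 0) < e"
      by (auto simp: infdist_nonneg)
  qed
  with \<open>x \<in> A\<close> show thesis by (rule that)
qed

end

section \<open>Cosets\<close>

definition coset :: "'a::real_vector set \<Rightarrow> 'a \<Rightarrow> 'a set" where
  "coset I x = (\<lambda>d. d + x) ` I"

lemma a_r_coset_eq_coset: "add R = (+) \<Longrightarrow> I +>\<^bsub>R\<^esub> x = coset I x"
  by (auto simp: a_r_coset_def' coset_def)

lemma coset_eqI:
  assumes I: "subspace I" and "x - y \<in> I"
  shows "coset I x = coset I y"
proof -
  have le: "coset I u \<subseteq> coset I v" if "u - v \<in> I" for u v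
  proof
    fix z assume "z \<in> coset I u"
    then obtain d where "d \<in> I" "z = d + u" by (auto simp: coset_def)
    then have "z = (d + (u - v)) + v" "d + (u - v) \<in> I"
      using subspace_add[OF I] that by auto
    then show "z \<in> coset I v" unfolding coset_def by blast
  qed
  have "y - x \<in> I" using subspace_neg[OF I assms(2)] by simp
  with assms le show ?thesis by (intro antisym) auto
qed

lemma coset_eq_iff:
  assumes I: "subspace I"
  shows "coset I x = coset I y \<longleftrightarrow> x - y \<in> I"
proof
  assume eq: "coset I x = coset I y"
  have "x \<in> coset I x" unfolding coset_def using subspace_0[OF I] by force
  then obtain d where "d \<in> I" "x = d + y" using eq by (auto simp: coset_def)
  then show "x - y \<in> I" by simp
qed (rule coset_eqI[OF I])

text \<open>The induced operations are unions over all representatives. When \<open>g\<close>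
  respects congruence modulo \<open>I\<close>, the sets in the union coincide.\<close>

lemma UN_coset:
  assumes I: "subspace I" and g: "\<And>d. d \<in> I \<Longrightarrow> g (d + x) - g x \<in> I"
  shows "(\<Union>y\<in>coset I x. coset I (g y)) = coset I (g x)"
proof -
  have "coset I (g y) = coset I (g x)" if "y \<in> coset I x" for y
    using that g by (auto simp: coset_def intro!: coset_eqI[OF I, unfolded coset_def])
  moreover have "coset I x \<noteq> {}" using subspace_0[OF I] by (auto simp: coset_def)
  ultimately show ?thesis by auto
qed

lemma UN_coset2:
  assumes I: "subspace I"
    and g: "\<And>d e. \<lbrakk>d \<in> I; e \<in> I\<rbrakk> \<Longrightarrow> g (d + x) (e + y) - g x y \<in> I"
  shows "(\<Union>u\<in>coset I x. \<Union>v\<in>coset I y. coset I (g u v)) = coset I (g x y)"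
proof -
  have "coset I (g u v) = coset I (g x y)" if "u \<in> coset I x" "v \<in> coset I y" for u v
    using that g by (auto simp: coset_def intro!: coset_eqI[OF I, unfolded coset_def])
  moreover have "coset I x \<noteq> {}" "coset I y \<noteq> {}" using subspace_0[OF I] by (auto simp: coset_def)
  ultimately show ?thesis by auto
qed

lemma set_add_coset:
  assumes I: "subspace I" and R: "add R = (+)"
  shows "set_add R (coset I x) (coset I y) = coset I (x + y)"
proof -
  have "set_add R (coset I x) (coset I y) = (\<Union>d\<in>I. \<Union>e\<in>I. {(d + x) + (e + y)})"
    by (auto simp: set_add_defs R coset_def)
  also have "\<dots> = coset I (x + y)"
  proof (intro antisym subsetI)
    fix z assume "z \<in> (\<Union>d\<in>I. \<Union>e\<in>I. {(d + x) + (e + y)})"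
    then obtain d e where "d \<in> I" "e \<in> I" "z = (d + e) + (x + y)" by (auto simp: ac_simps)
    then show "z \<in> coset I (x + y)" unfolding coset_def using subspace_add[OF I] by blast
  next
    fix z assume "z \<in> coset I (x + y)"
    then obtain d where "d \<in> I" "z = (d + x) + (0 + y)" by (auto simp: coset_def add.assoc)
    then show "z \<in> (\<Union>d\<in>I. \<Union>e\<in>I. {(d + x) + (e + y)})" using subspace_0[OF I] by blast
  qed
  finally show ?thesis .
qed

lemma INF_norm_coset:
  fixes x :: "'a::real_normed_vector"
  assumes I: "subspace I"
  shows "(INF y\<in>coset I x. norm y) = infdist x I"
proof -
  have "norm ` coset I x = dist x ` I"
  proof (intro antisym subsetI)
    fix z assume "z \<in> norm ` coset I x"
    then obtain d where "d \<in> I" "z = dist x (- d)"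
      by (auto simp: coset_def dist_norm add.commute)
    then show "z \<in> dist x ` I" using subspace_neg[OF I] by blast
  next
    fix z assume "z \<in> dist x ` I"
    then obtain d where "d \<in> I" "z = norm (- d + x)" by (auto simp: dist_norm)
    then show "z \<in> norm ` coset I x" unfolding coset_def using subspace_neg[OF I] by blast
  qed
  then show ?thesis using subspace_0[OF I] by (auto simp: infdist_def)
qed

text \<open>Presents \<open>V\<close> by representatives: \<open>f\<close> need not be injective,
  and \<open>N\<close> is a seminorm whose null elements in \<open>S\<close> are those identified
  with \<open>0\<close>. The Banach space axioms are then checked in \<open>S\<close>, for real and
  complex scalars at once, whether \<open>f\<close> is the identity or a coset map.\<close>

locale normed_module_image =
  fixes V :: "('k::real_normed_field, 'b, 'm) normed_module_scheme" (structure)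
    and f :: "'a::ab_group_add \<Rightarrow> 'b" and S :: "'a set"
    and sc :: "'k \<Rightarrow> 'a \<Rightarrow> 'a" and N :: "'a \<Rightarrow> real"
  assumes carrier_image: "carrier V = f ` S"
    and zero_S: "0 \<in> S"
    and add_S: "\<lbrakk>x \<in> S; y \<in> S\<rbrakk> \<Longrightarrow> x + y \<in> S"
    and minus_S: "x \<in> S \<Longrightarrow> - x \<in> S"
    and sc_S: "x \<in> S \<Longrightarrow> sc c x \<in> S"
    and sc_add_left: "sc (c + d) x = sc c x + sc d x"
    and sc_add_right: "sc c (x + y) = sc c x + sc c y"
    and sc_sc: "sc (c * d) x = sc c (sc d x)"
    and sc_one: "sc 1 x = x"
    and zero_image: "\<zero> = f 0"
    and add_image: "\<lbrakk>x \<in> S; y \<in> S\<rbrakk> \<Longrightarrow> f x \<oplus> f y = f (x + y)"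
    and smult_image: "x \<in> S \<Longrightarrow> c \<odot> f x = f (sc c x)"
    and nrm_image: "x \<in> S \<Longrightarrow> nrm V (f x) = N x"
    and N_nonneg: "0 \<le> N x"
    and N_eq_0_iff: "x \<in> S \<Longrightarrow> N x = 0 \<longleftrightarrow> f x = f 0"
    and N_add: "N (x + y) \<le> N x + N y"
    and N_sc: "N (sc c x) = norm c * N x"
    and N_complete: "\<lbrakk>\<And>n::nat. s n \<in> S;
        \<And>e. 0 < e \<Longrightarrow> \<exists>M. \<forall>m\<ge>M. \<forall>n\<ge>M. N (s m - s n) < e\<rbrakk>
       \<Longrightarrow> \<exists>x\<in>S. (\<lambda>n. N (s n - x)) \<longlonglongrightarrow> 0"
begin

lemma diff_S: "\<lbrakk>x \<in> S; y \<in> S\<rbrakk> \<Longrightarrow> x - y \<in> S"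
  using add_S[of x "- y"] minus_S by simp

lemma abelian_group_V: "abelian_group V"
proof (rule abelian_groupI)
  fix u assume "u \<in> carrier V"
  then obtain x where x: "x \<in> S" "u = f x" by (auto simp: carrier_image)
  then have "f (- x) \<in> carrier V" "f (- x) \<oplus> u = \<zero>"
    by (simp_all add: carrier_image minus_S add_image zero_image)
  then show "\<exists>v\<in>carrier V. v \<oplus> u = \<zero>" by blast
qed (auto simp: carrier_image zero_image add_image add_S zero_S add.assoc intro: arg_cong[OF add.commute])

lemma a_inv_image: "x \<in> S \<Longrightarrow> \<ominus> f x = f (- x)"
  by (rule abelian_group.minus_equality[OF abelian_group_V])
    (auto simp: carrier_image zero_image add_image minus_S)

lemma a_minus_image: "\<lbrakk>x \<in> S; y \<in> S\<rbrakk> \<Longrightarrow> f x \<ominus> f y = f (x - y)"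
  by (simp add: a_minus_def a_inv_image add_image minus_S)

lemma banach_space_on_V: "banach_space_on V"
proof -
  have N0: "nrm V (f 0) = 0" using N_eq_0_iff[OF zero_S] by (simp add: nrm_image zero_S)
  have cring: "cring (ring_of_type_algebra :: 'k ring)" by (rule cring_from_type_algebra)
  have "Module.module (ring_of_type_algebra :: 'k ring) V"
    by (rule moduleI[OF cring abelian_group_V])
      (auto simp: ring_of_type_algebra_def carrier_image smult_image add_image sc_S add_S
        sc_add_left sc_add_right sc_sc sc_one)
  moreover have "banach_space_on_axioms V"
  proof (rule banach_space_on_axioms.intro)
    fix s :: "nat \<Rightarrow> 'b"
    assume s: "\<And>n. s n \<in> carrier V"
      and Cauchy: "\<And>e. 0 < e \<Longrightarrow> \<exists>M. \<forall>m\<ge>M. \<forall>n\<ge>M. nrm V (s m \<ominus> s n) < e"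
    have "\<forall>n. \<exists>x. x \<in> S \<and> s n = f x" using s by (auto simp: carrier_image)
    then obtain t where t: "\<And>n. t n \<in> S" "\<And>n. s n = f (t n)" by metis
    have diff: "nrm V (s n \<ominus> f x) = N (t n - x)" if "x \<in> S" for n x
      by (simp add: t a_minus_image nrm_image diff_S that)
    have "\<exists>M. \<forall>m\<ge>M. \<forall>n\<ge>M. N (t m - t n) < e" if "0 < e" for e
      using Cauchy[OF that] diff[OF t(1)] by (simp add: t(2))
    from N_complete[OF t(1) this] obtain x where "x \<in> S" "(\<lambda>n. N (t n - x)) \<longlonglongrightarrow> 0" by blast
    then show "\<exists>x\<in>carrier V. (\<lambda>n. nrm V (s n \<ominus> x)) \<longlonglongrightarrow> 0"
      by (auto simp: carrier_image diff)
  qed (auto simp: carrier_image nrm_image N0 N_nonneg N_eq_0_iff zero_image add_image smult_image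
      add_S sc_S N_add N_sc)
  ultimately show ?thesis by (rule banach_space_on.intro)
qed

end

section \<open>Jordan product and Lie bracket in a C*-algebra\<close>

definition jordan :: "'a::unital_cstar_algebra \<Rightarrow> 'a \<Rightarrow> 'a" where
  "jordan a b = (1/2) *\<^sub>C (a * b + b * a)"

definition lie_bracket :: "real \<Rightarrow> 'a::unital_cstar_algebra \<Rightarrow> 'a \<Rightarrow> 'a" where
  "lie_bracket lam a b = (\<i> * complex_of_real lam) *\<^sub>C (a * b - b * a)"

text \<open>Moves scalars outwards, so that the identities below reduce to polynomial identities in
  noncommuting variables, which \<open>algebra_simps\<close> settles.\<close>

lemmas scaleC_simps = mult_scaleC_left mult_scaleC_right scaleC_scaleC scaleC_minus_right
  scaleC_add_right[symmetric] scaleC_diff_right[symmetric]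

lemma jordan_self: "jordan a a = a * a"
  using scaleC_of_real[of "1/2" "a * a + a * a"] by (simp add: jordan_def flip: scaleR_2)

lemma jordan_commute: "jordan a b = jordan b a"
  unfolding jordan_def by (rule arg_cong[OF add.commute])

lemma jordan_add_left: "jordan (a + b) c = jordan a c + jordan b c"
  unfolding jordan_def scaleC_add_right[symmetric] by (simp add: algebra_simps)

lemma jordan_scaleR_left: "jordan (r *\<^sub>R a) b = r *\<^sub>R jordan a b"
  by (simp add: jordan_def scaleC_scaleR flip: scaleR_add_right)

lemma jordan_identity: "jordan (jordan (jordan a a) b) a = jordan (jordan a a) (jordan b a)"
  unfolding jordan_self
  by (simp add: jordan_def scaleC_simps) (simp add: algebra_simps)

lemma lie_bracket_antisym: "lie_bracket lam a b = - lie_bracket lam b a"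
  by (simp add: lie_bracket_def scaleC_diff_right)

lemma lie_bracket_add_left: "lie_bracket lam (a + b) c = lie_bracket lam a c + lie_bracket lam b c"
  unfolding lie_bracket_def scaleC_add_right[symmetric] by (simp add: algebra_simps)

lemma lie_bracket_scaleR_left: "lie_bracket lam (r *\<^sub>R a) b = r *\<^sub>R lie_bracket lam a b"
  by (simp add: lie_bracket_def scaleC_scaleR flip: scaleR_diff_right)

lemma lie_bracket_jacobi:
  "lie_bracket lam a (lie_bracket lam b c) + lie_bracket lam b (lie_bracket lam c a)
    + lie_bracket lam c (lie_bracket lam a b) = 0"
  by (simp add: lie_bracket_def scaleC_simps) (simp add: algebra_simps)

lemma lie_bracket_leibniz:
  "lie_bracket lam a (jordan b c) = jordan (lie_bracket lam a b) c + jordan b (lie_bracket lam a c)"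
  by (simp add: lie_bracket_def jordan_def scaleC_simps mult.commute) (simp add: algebra_simps)

lemma jordan_associator:
  assumes "lam \<noteq> 0"
  shows "jordan (jordan a b) c - jordan a (jordan b c)
    = (1 / (2 * lam))\<^sup>2 *\<^sub>R lie_bracket lam b (lie_bracket lam c a)"
proof -
  \<comment> \<open>Two brackets contribute \<open>(\<i> * lam)\<^sup>2\<close>, two Jordan products
    contribute \<open>1/4\<close>. The factor \<open>1 / (2 * lam)\<close> balances them up to a
    sign, which the commutator expansion supplies.\<close>
  have "complex_of_real ((1 / (2 * lam))\<^sup>2) * ((\<i> * lam) * (\<i> * lam)) = - (1/4)"
    using assms by (simp add: power2_eq_square field_simps)
  then have "(1 / (2 * lam))\<^sup>2 *\<^sub>R lie_bracket lam b (lie_bracket lam c a)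
    = (- (1/4)) *\<^sub>C (b * (c * a - a * c) - (c * a - a * c) * b)"
    unfolding scaleC_of_real[symmetric]
    by (simp add: lie_bracket_def scaleC_simps mult.assoc[of _ "_ * _" "_ * _"])
  moreover have "jordan (jordan a b) c - jordan a (jordan b c)
    = (1/4) *\<^sub>C (((a * b + b * a) * c + c * (a * b + b * a))
        - (a * (b * c + c * b) + (b * c + c * b) * a))"
    by (simp add: jordan_def scaleC_simps)
  moreover have "((a * b + b * a) * c + c * (a * b + b * a)) - (a * (b * c + c * b) + (b * c + c * b) * a)
    = - (b * (c * a - a * c) - (c * a - a * c) * b)"
    by (simp add: algebra_simps)
  ultimately show ?thesis by (simp only: scaleC_minus_left scaleC_minus_right)
qed

lemma star_jordan: "star (jordan a b) = jordan (star a) (star b)"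
  by (simp add: jordan_def star_scaleC star_add star_mult add.commute)

lemma star_lie_bracket: "star (lie_bracket lam a b) = lie_bracket lam (star a) (star b)"
  by (simp add: lie_bracket_def star_scaleC star_diff star_mult scaleC_diff_right)

section \<open>Quotient algebras\<close>

context closed_star_ideal
begin

lemma subspace_D: "subspace D"
  by (rule subspaceI) (auto simp: zero_D add_D scaleR_D)

lemma subspace_self_adjoint_D: "subspace (self_adjoint D)"
  by (rule subspaceI) (auto simp: self_adjoint_def zero_D add_D scaleR_D star_add star_scaleR)

lemma jordan_A: "\<lbrakk>a \<in> A; b \<in> A\<rbrakk> \<Longrightarrow> jordan a b \<in> A"
  unfolding jordan_def by (intro scaleC_A add_A mult_A)

lemma lie_bracket_A: "\<lbrakk>a \<in> A; b \<in> A\<rbrakk> \<Longrightarrow> lie_bracket lam a b \<in> A"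
  unfolding lie_bracket_def by (intro scaleC_A diff_A mult_A)

lemma jordan_self_adjoint:
  "\<lbrakk>a \<in> self_adjoint A; b \<in> self_adjoint A\<rbrakk> \<Longrightarrow> jordan a b \<in> self_adjoint A"
  by (simp add: self_adjoint_def jordan_A star_jordan)

lemma lie_bracket_self_adjoint:
  "\<lbrakk>a \<in> self_adjoint A; b \<in> self_adjoint A\<rbrakk> \<Longrightarrow> lie_bracket lam a b \<in> self_adjoint A"
  by (simp add: self_adjoint_def lie_bracket_A star_lie_bracket)

lemma infdist_D_jordan:
  assumes "a \<in> A" "b \<in> A"
  shows "infdist (jordan a b) D \<le> infdist a D * infdist b D"
  using infdist_D_add[of "a * b" "b * a"] infdist_D_mult[OF assms] infdist_D_mult[OF assms(2,1)]
  by (simp add: jordan_def infdist_D_scaleC mult.commute)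

lemma infdist_D_lie_bracket:
  assumes "a \<in> A" "b \<in> A"
  shows "infdist (lie_bracket lam a b) D \<le> 2 * \<bar>lam\<bar> * infdist a D * infdist b D"
proof -
  have "infdist (a * b - b * a) D \<le> 2 * (infdist a D * infdist b D)"
    using infdist_D_diff[of "a * b" "b * a"] infdist_D_mult[OF assms] infdist_D_mult[OF assms(2,1)]
    by (simp add: mult.commute)
  then have "\<bar>lam\<bar> * infdist (a * b - b * a) D \<le> \<bar>lam\<bar> * (2 * (infdist a D * infdist b D))"
    by (rule mult_left_mono) simp
  then show ?thesis by (simp add: lie_bracket_def infdist_D_scaleC norm_mult mult_ac)
qed

lemma infdist_self_adjoint_D:
  assumes "star x = x"
  shows "infdist x (self_adjoint D) = infdist x D"
proof (rule antisym)
  show "infdist x (self_adjoint D) \<le> infdist x D"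
  proof (rule dense_ge)
    fix r assume "infdist x D < r"
    then obtain d where d: "d \<in> D" "star d = d" "norm (x + d) < r"
      using infdist_D_less_self_adjoint assms by blast
    then have "infdist x (self_adjoint D) \<le> dist x (- d)"
      by (intro infdist_le) (simp add: self_adjoint_def minus_D)
    with d show "infdist x (self_adjoint D) \<le> r" by (simp add: dist_norm)
  qed
  have "self_adjoint D \<noteq> {}" using subspace_0[OF subspace_self_adjoint_D] by blast
  then show "infdist x D \<le> infdist x (self_adjoint D)"
    by (intro infdist_mono) (auto simp: self_adjoint_def)
qed

end

text \<open>Describes \<open>B\<close> as \<open>A\<close> modulo \<open>D\<close>. The identity map
  with \<open>D = {0}\<close> gives the subalgebra, the coset map gives the quotient.\<close>

locale cstar_image = closed_star_ideal A D
  for A D :: "'a::unital_cstar_algebra set" +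
  fixes B :: "('b, 'm) star_algebra_scheme" (structure) and f :: "'a \<Rightarrow> 'b"
  assumes carrier_image: "carrier B = f ` A"
    and eq_iff: "\<lbrakk>x \<in> A; y \<in> A\<rbrakk> \<Longrightarrow> f x = f y \<longleftrightarrow> x - y \<in> D"
    and zero_image: "\<zero> = f 0"
    and one_image: "\<one> = f 1"
    and add_image: "\<lbrakk>x \<in> A; y \<in> A\<rbrakk> \<Longrightarrow> f x \<oplus> f y = f (x + y)"
    and mult_image: "\<lbrakk>x \<in> A; y \<in> A\<rbrakk> \<Longrightarrow> f x \<otimes> f y = f (x * y)"
    and smult_image: "x \<in> A \<Longrightarrow> c \<odot> f x = f (c *\<^sub>C x)"
    and nrm_image: "x \<in> A \<Longrightarrow> nrm B (f x) = infdist x D"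
    and adj_image: "x \<in> A \<Longrightarrow> adj B (f x) = f (star x)"
begin

sublocale normed_module_image B f A scaleC "\<lambda>x. infdist x D"
proof
  fix s :: "nat \<Rightarrow> 'a"
  assume "\<And>n. s n \<in> A" "\<And>e. 0 < e \<Longrightarrow> \<exists>M. \<forall>m\<ge>M. \<forall>n\<ge>M. infdist (s m - s n) D < e"
  then obtain x where "x \<in> A" "(\<lambda>n. infdist (s n - x) D) \<longlonglongrightarrow> 0"
    by (rule infdist_D_complete)
  then show "\<exists>x\<in>A. (\<lambda>n. infdist (s n - x) D) \<longlonglongrightarrow> 0" by blast
next
  fix x assume "x \<in> A"
  then show "infdist x D = 0 \<longleftrightarrow> f x = f 0" using eq_iff[OF _ zero_A] by (simp only: infdist_D_eq_0_iff diff_zero)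
qed (use scaleC_scaleC in \<open>simp_all add: carrier_image zero_A add_A minus_A scaleC_A scaleC_add_left
    scaleC_add_right zero_image add_image smult_image nrm_image infdist_nonneg
    infdist_D_add infdist_D_scaleC\<close>)

lemma unital_cstar_algebra_on_B: "unital_cstar_algebra_on B"
proof (rule unital_cstar_algebra_on.intro)
  have "monoid B"
    by (rule monoidI) (auto simp: carrier_image one_image mult_image mult_A one_A mult.assoc)
  then show "Ring.ring B"
    by (rule ringI[OF abelian_group_V])
      (auto simp: carrier_image add_image mult_image add_A mult_A algebra_simps)
  show "unital_cstar_algebra_on_axioms B"
    by (rule unital_cstar_algebra_on_axioms.intro)
      (auto simp: carrier_image add_image mult_image smult_image adj_image nrm_image
        add_A mult_A scaleC_A star_A mult_scaleC_left mult_scaleC_right star_star star_add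
        star_scaleC star_mult infdist_D_mult infdist_D_star_mult)
qed (rule banach_space_on_V)

lemma carrier_sa_part: "carrier (sa_part lam B) = f ` self_adjoint A"
proof (intro antisym subsetI)
  fix u assume "u \<in> carrier (sa_part lam B)"
  then obtain x where x: "x \<in> A" "u = f x" "f (star x) = f x"
    by (auto simp: sa_part_def carrier_image adj_image)
  then have "star x - x \<in> D" using eq_iff star_A by blast
  then have "(- (1/2)) *\<^sub>R (star x - x) \<in> D" by (rule scaleR_D)
  moreover have "(- (1/2)) *\<^sub>R (star x - x) = x - real_part x"
    by (simp add: real_part_def algebra_simps flip: scaleR_add_left)
  ultimately have "u = f (real_part x)" using x eq_iff real_part_A by simp
  then show "u \<in> f ` self_adjoint A"
    using x by (auto simp: self_adjoint_def real_part_A star_real_part)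
qed (auto simp: sa_part_def carrier_image adj_image self_adjoint_def)

end

text \<open>Kernel and norm refer to \<open>D\<close> even when \<open>L\<close> is a quotient by
  \<open>J\<close>: for self-adjoint representatives, congruence modulo \<open>D\<close> is
  congruence modulo \<open>J\<close>, and the two distances agree. Both sides of the theorem thus
  become instances that differ only in \<open>L\<close> and \<open>f\<close>.\<close>

locale lie_jordan_image = closed_star_ideal A D
  for A D :: "'a::unital_cstar_algebra set" +
  fixes lam :: real and L :: "('b, 'm) lie_jordan_algebra_scheme" (structure) and f :: "'a \<Rightarrow> 'b"
  assumes lam_nonzero: "lam \<noteq> 0"
    and carrier_image: "carrier L = f ` self_adjoint A"
    and eq_iff: "\<lbrakk>x \<in> self_adjoint A; y \<in> self_adjoint A\<rbrakk> \<Longrightarrow> f x = f y \<longleftrightarrow> x - y \<in> D"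
    and zero_image: "\<zero> = f 0"
    and one_image: "\<one> = f 1"
    and add_image: "\<lbrakk>x \<in> self_adjoint A; y \<in> self_adjoint A\<rbrakk> \<Longrightarrow> f x \<oplus> f y = f (x + y)"
    and smult_image: "x \<in> self_adjoint A \<Longrightarrow> r \<odot> f x = f (r *\<^sub>R x)"
    and nrm_image: "x \<in> self_adjoint A \<Longrightarrow> nrm L (f x) = infdist x D"
    and jordan_image: "\<lbrakk>x \<in> self_adjoint A; y \<in> self_adjoint A\<rbrakk> \<Longrightarrow> f x \<otimes> f y = f (jordan x y)"
    and lie_image: "\<lbrakk>x \<in> self_adjoint A; y \<in> self_adjoint A\<rbrakk>
      \<Longrightarrow> lie L (f x) (f y) = f (lie_bracket lam x y)"
begin

sublocale normed_module_image L f "self_adjoint A" scaleR "\<lambda>x. infdist x D"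
proof
  fix s :: "nat \<Rightarrow> 'a"
  assume s: "\<And>n. s n \<in> self_adjoint A"
    and Cauchy: "\<And>e. 0 < e \<Longrightarrow> \<exists>M. \<forall>m\<ge>M. \<forall>n\<ge>M. infdist (s m - s n) D < e"
  have "s n \<in> A" for n using s by (simp add: self_adjoint_def)
  then obtain x where x: "x \<in> A" "(\<lambda>n. infdist (s n - x) D) \<longlonglongrightarrow> 0"
    using infdist_D_complete Cauchy by blast
  \<comment> \<open>The limit found in \<open>A\<close> need not be self-adjoint. Its real part is a
    limit too, since taking real parts does not increase the distance to \<open>D\<close>.\<close>
  have "infdist (s n - real_part x) D \<le> infdist (s n - x) D" for n
    using infdist_D_real_part_le[of "s n - x"] s[of n]
    by (simp add: self_adjoint_def real_part_diff real_part_self_adjoint)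
  then have "(\<lambda>n. infdist (s n - real_part x) D) \<longlonglongrightarrow> 0"
    by (intro tendsto_sandwich[OF _ _ tendsto_const x(2)]) (simp_all add: infdist_nonneg)
  moreover have "real_part x \<in> self_adjoint A"
    by (simp add: self_adjoint_def real_part_A star_real_part x)
  ultimately show "\<exists>x\<in>self_adjoint A. (\<lambda>n. infdist (s n - x) D) \<longlonglongrightarrow> 0" by blast
next
  show "0 \<in> self_adjoint A" by (simp add: self_adjoint_def zero_A)
  fix x assume "x \<in> self_adjoint A"
  then show "infdist x D = 0 \<longleftrightarrow> f x = f 0" using eq_iff[of x 0] \<open>0 \<in> self_adjoint A\<close>
    by (simp only: infdist_D_eq_0_iff diff_zero)
qed (simp_all add: carrier_image zero_image add_image smult_image nrm_image infdist_nonneg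
    infdist_D_add infdist_D_scaleR scaleR_add_left scaleR_add_right,
    simp_all add: self_adjoint_def add_A minus_A scaleR_A star_add star_scaleR)

lemma lie_jordan_banach_algebra_L: "lie_jordan_banach_algebra (1 / (2 * lam)) L"
proof -
  note closed = jordan_self_adjoint lie_bracket_self_adjoint add_S sc_S
  note image = carrier_image add_image smult_image a_inv_image a_minus_image jordan_image lie_image
    nrm_image zero_image
  have square_add: "infdist (jordan x x) D \<le> infdist (jordan x x + jordan y y) D"
    if "x \<in> self_adjoint A" "y \<in> self_adjoint A" for x y
    using that by (simp add: self_adjoint_def jordan_self infdist_D_square_le_square_add)
  have square: "infdist (jordan x x) D = infdist x D ^ 2" if "x \<in> self_adjoint A" for x
    using that infdist_D_star_mult[of x] by (simp add: self_adjoint_def jordan_self)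
  \<comment> \<open>The constant is the inverse of the absolute value of
    \<open>1 / (2 * lam)\<close>.\<close>
  have lie: "infdist (lie_bracket lam x y) D
      \<le> \<bar>2 * lam\<bar> * infdist x D * infdist y D"
    if "x \<in> self_adjoint A" "y \<in> self_adjoint A" for x y
    using that infdist_D_lie_bracket[of x y lam] by (simp add: self_adjoint_def abs_mult)
  have jor: "infdist (jordan x y) D \<le> infdist x D * infdist y D"
    if "x \<in> self_adjoint A" "y \<in> self_adjoint A" for x y
    using that by (simp add: self_adjoint_def infdist_D_jordan)
  have "lie_jordan_banach_algebra_axioms (1 / (2 * lam)) L"
  proof (rule lie_jordan_banach_algebra_axioms.intro)
    show "1 / (2 * lam) \<noteq> 0" using lam_nonzero by simp
  next
    fix a b assume "a \<in> carrier L" "b \<in> carrier L"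
    then show "a \<otimes> b = b \<otimes> a" by (auto simp: image intro: arg_cong[OF jordan_commute])
  next
    fix a b assume "a \<in> carrier L" "b \<in> carrier L"
    then show "lie L a b = \<ominus> lie L b a"
      by (auto simp: image closed intro: arg_cong[OF lie_bracket_antisym])
  next
    fix a b c assume "a \<in> carrier L" "b \<in> carrier L" "c \<in> carrier L"
    then obtain x y z where x: "x \<in> self_adjoint A" "a = f x" and y: "y \<in> self_adjoint A" "b = f y"
      and z: "z \<in> self_adjoint A" "c = f z"
      by (auto simp: carrier_image)
    note xyz = x y z
    show "(a \<oplus> b) \<otimes> c = (a \<otimes> c) \<oplus> (b \<otimes> c)"
      by (simp add: xyz image closed jordan_add_left)
    show "lie L (a \<oplus> b) c = lie L a c \<oplus> lie L b c"
      by (simp add: xyz image closed lie_bracket_add_left)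
    show "lie L a (lie L b c) \<oplus> lie L b (lie L c a) \<oplus> lie L c (lie L a b) = \<zero>"
      by (simp add: xyz image closed lie_bracket_jacobi)
    show "lie L a (b \<otimes> c) = (lie L a b \<otimes> c) \<oplus> (b \<otimes> lie L a c)"
      by (simp add: xyz image closed lie_bracket_leibniz)
    show "((a \<otimes> b) \<otimes> c) \<ominus> (a \<otimes> (b \<otimes> c)) = (1 / (2 * lam)) ^ 2 \<odot> lie L b (lie L c a)"
      by (simp only: xyz image closed jordan_associator[OF lam_nonzero])
  qed (auto simp: image closed jordan_scaleR_left lie_bracket_scaleR_left jordan_identity
      jor lie intro: square square_add)
  then show ?thesis by (intro lie_jordan_banach_algebra.intro banach_space_on_V)
qed

end

text \<open>Both algebras have the same representatives and the same kernel, so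
  \<open>\<phi>\<close> is bijective; operations and norms on either side are read off the same
  representative.\<close>

lemma lie_jordan_banach_iso_images:
  assumes 1: "lie_jordan_image A D lam L f" and 2: "lie_jordan_image A D lam M g"
    and \<phi>: "\<And>x. x \<in> self_adjoint A \<Longrightarrow> \<phi> (f x) = g x"
  shows "lie_jordan_banach_iso \<phi> L M"
proof -
  interpret L: lie_jordan_image A D lam L f by (rule 1)
  interpret M: lie_jordan_image A D lam M g by (rule 2)
  have one: "1 \<in> self_adjoint A" by (simp add: self_adjoint_def L.one_A)
  have "bij_betw \<phi> (carrier L) (carrier M)"
    by (auto simp: bij_betw_def inj_on_def L.carrier_image M.carrier_image \<phi> L.eq_iff M.eq_iff
        image_image)
  then show ?thesis unfolding lie_jordan_banach_iso_def
    by (auto simp: L.carrier_image L.add_image M.add_image L.smult_image M.smult_image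
        L.jordan_image M.jordan_image L.lie_image M.lie_image L.nrm_image M.nrm_image
        L.one_image M.one_image one \<phi> L.add_S L.sc_S L.jordan_self_adjoint
        L.lie_bracket_self_adjoint)
qed

context cstar_image
begin

lemma lie_jordan_image_sa_part:
  assumes "lam \<noteq> 0"
  shows "lie_jordan_image A D lam (sa_part lam B) f"
proof unfold_locales
  show "carrier (sa_part lam B) = f ` self_adjoint A" by (rule carrier_sa_part)
qed (auto simp: assms sa_part_def self_adjoint_def eq_iff zero_image one_image add_image smult_image
    nrm_image mult_image a_minus_image mult_A add_A diff_A jordan_def lie_bracket_def
    scaleC_of_real)

end

section \<open>The subalgebra, its quotient by \<open>D\<close> and the Lie-Jordan quotient by
  \<open>J\<close>\<close>

context closed_star_ideal
begin

lemma cstar_image_cstar_sub: "cstar_image A {0} (cstar_sub A) (\<lambda>x. x)"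
proof -
  interpret zero: closed_star_ideal A "{0}"
    by unfold_locales
      (auto simp: closed_A one_A add_A mult_A scaleC_A star_A zero_A)
  show ?thesis by unfold_locales (simp_all add: cstar_sub_def)
qed

lemma ideal_D: "ideal D (cstar_sub A)"
proof (rule idealI)
  interpret sub: cstar_image A "{0}" "cstar_sub A" "\<lambda>x. x" by (rule cstar_image_cstar_sub)
  show "Ring.ring (cstar_sub A)"
    using sub.unital_cstar_algebra_on_B by (rule unital_cstar_algebra_on.axioms)
  have inv: "inv\<^bsub>add_monoid (cstar_sub A)\<^esub> x = - x" if "x \<in> D" for x
    using sub.a_inv_image[OF in_A[OF that]] by (simp add: a_inv_def)
  show "subgroup D (add_monoid (cstar_sub A))"
    by (rule subgroup.intro)
      (use inv in \<open>auto simp: cstar_sub_def in_A add_D zero_D minus_D\<close>)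
qed (simp_all add: cstar_sub_def mult_left_D mult_right_D)

lemma cstar_image_cstar_quot: "cstar_image A D (cstar_quot (cstar_sub A) D) (coset D)"
proof -
  have cs: "D +>\<^bsub>cstar_sub A\<^esub> x = coset D x" for x
    by (rule a_r_coset_eq_coset) (simp add: cstar_sub_def)
  show ?thesis
  proof unfold_locales
    fix x y assume x: "x \<in> A" and y: "y \<in> A"
    show "coset D x = coset D y \<longleftrightarrow> x - y \<in> D" by (rule coset_eq_iff[OF subspace_D])
    show "coset D x \<oplus>\<^bsub>cstar_quot (cstar_sub A) D\<^esub> coset D y = coset D (x + y)"
      using set_add_coset[OF subspace_D, of "cstar_sub A"]
      by (simp add: cstar_quot_def FactRing_def cstar_sub_def)
    have "(d + x) * (e + y) - x * y \<in> D" if "d \<in> D" "e \<in> D" for d e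
    proof -
      have "(d + x) * (e + y) - x * y = d * e + d * y + x * e" by (simp add: algebra_simps)
      also have "\<dots> \<in> D"
        by (intro add_D mult_left_D mult_right_D that x y) (rule in_A[OF that(1)])
      finally show ?thesis .
    qed
    from UN_coset2[OF subspace_D, where g = "(*)" and x = x and y = y, OF this]
    show "coset D x \<otimes>\<^bsub>cstar_quot (cstar_sub A) D\<^esub> coset D y = coset D (x * y)"
      by (simp add: cstar_quot_def FactRing_def rcoset_mult_def cs) (simp add: cstar_sub_def)
  next
    fix x c assume x: "x \<in> A"
    have "c *\<^sub>C (d + x) - c *\<^sub>C x \<in> D" if "d \<in> D" for d
      using that by (simp add: scaleC_add_right scaleC_D)
    from UN_coset[OF subspace_D, where g = "(*\<^sub>C) c" and x = x, OF this]
    show "c \<odot>\<^bsub>cstar_quot (cstar_sub A) D\<^esub> coset D x = coset D (c *\<^sub>C x)"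
      by (simp add: cstar_quot_def coset_map_def cs) (simp add: cstar_sub_def)
    have "star (d + x) - star x \<in> D" if "d \<in> D" for d
      using that by (simp add: star_add star_D)
    from UN_coset[OF subspace_D, where g = star and x = x, OF this]
    show "adj (cstar_quot (cstar_sub A) D) (coset D x) = coset D (star x)"
      by (simp add: cstar_quot_def coset_map_def cs) (simp add: cstar_sub_def)
    show "nrm (cstar_quot (cstar_sub A) D) (coset D x) = infdist x D"
      using INF_norm_coset[OF subspace_D, of x]
      by (simp add: cstar_quot_def coset_nrm_def cstar_sub_def)
  next
    show "carrier (cstar_quot (cstar_sub A) D) = coset D ` A"
      by (auto simp: cstar_quot_def FactRing_def A_RCOSETS_def' cs) (auto simp: cstar_sub_def)
    show "\<zero>\<^bsub>cstar_quot (cstar_sub A) D\<^esub> = coset D 0"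
      by (simp add: cstar_quot_def FactRing_def coset_def)
    show "\<one>\<^bsub>cstar_quot (cstar_sub A) D\<^esub> = coset D 1"
      by (simp add: cstar_quot_def FactRing_def cs) (simp add: cstar_sub_def)
  qed
qed

text \<open>Compatibility of the product and the bracket with \<open>J\<close> splits in two: a
  change of representatives alters the result by an element of \<open>D\<close>, because
  \<open>D\<close> is an ideal, and by a self-adjoint one, because both operations preserve
  self-adjointness.\<close>

lemma lie_jordan_image_lie_jordan_quot:
  assumes lam: "lam \<noteq> 0"
  defines "L \<equiv> sa_part lam (cstar_sub A)" and "J \<equiv> self_adjoint D"
  shows "lie_jordan_image A D lam (lie_jordan_quot L J) (coset J)"
proof -
  interpret sub: cstar_image A "{0}" "cstar_sub A" "\<lambda>x. x" by (rule cstar_image_cstar_sub)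
  interpret sa: lie_jordan_image A "{0}" lam L "\<lambda>x. x"
    unfolding L_def by (rule sub.lie_jordan_image_sa_part[OF lam])
  have add: "add L = (+)" by (simp add: L_def sa_part_def cstar_sub_def)
  have smult: "smult L r x = r *\<^sub>R x" for r x
    by (simp add: L_def sa_part_def cstar_sub_def scaleC_of_real)
  have nrm: "nrm L = norm" by (simp add: L_def sa_part_def cstar_sub_def)
  have mult: "monoid.mult L = jordan"
    by (intro ext) (simp add: L_def sa_part_def cstar_sub_def jordan_def)
  note cs = a_r_coset_eq_coset[OF add, of J]
  have J: "subspace J" unfolding J_def by (rule subspace_self_adjoint_D)
  have JD: "d \<in> self_adjoint A" "d \<in> D" if "d \<in> J" for d
    using that in_A by (auto simp: J_def self_adjoint_def)
  have JI: "d \<in> J" if "d \<in> D" "d \<in> self_adjoint A" for d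
    using that by (auto simp: J_def self_adjoint_def)
  have jordan_D: "jordan x d \<in> D" if "x \<in> A" "d \<in> D" for x d
    unfolding jordan_def by (intro scaleC_D add_D mult_left_D mult_right_D that)
  have lie_D: "lie_bracket lam x d \<in> D" if "x \<in> A" "d \<in> D" for x d
    unfolding lie_bracket_def by (intro scaleC_D diff_D mult_left_D mult_right_D that)
  show ?thesis
  proof unfold_locales
    fix x y assume x: "x \<in> self_adjoint A" and y: "y \<in> self_adjoint A"
    then have xA: "x \<in> A" and yA: "y \<in> A" by (auto simp: self_adjoint_def)
    show "coset J x = coset J y \<longleftrightarrow> x - y \<in> D"
      using coset_eq_iff[OF J, of x y] JD(2) JI sa.diff_S[OF x y] by blast
    show "coset J x \<oplus>\<^bsub>lie_jordan_quot L J\<^esub> coset J y = coset J (x + y)"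
      using set_add_coset[OF J add] by (simp add: lie_jordan_quot_def FactRing_def)
    have sum_A: "d + x \<in> self_adjoint A" if "d \<in> J" "x \<in> self_adjoint A" for d x
      using sa.add_S JD that by blast
    have "jordan (d + x) (e + y) - jordan x y \<in> J" if "d \<in> J" "e \<in> J" for d e
    proof (rule JI)
      have "jordan (d + x) (e + y) = jordan (e + y) d + (jordan x e + jordan x y)"
        using jordan_add_left[of d x "e + y"] jordan_add_left[of e y x]
        by (simp only: jordan_commute[of d "e + y"] jordan_commute[of x "e + y"]
            jordan_commute[of e x] jordan_commute[of y x])
      then have "jordan (d + x) (e + y) - jordan x y = jordan (e + y) d + jordan x e" by simp
      also have "\<dots> \<in> D"
        using that xA yA JD by (intro add_D jordan_D) (auto intro: add_A in_A)
      finally show "jordan (d + x) (e + y) - jordan x y \<in> D" .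
      show "jordan (d + x) (e + y) - jordan x y \<in> self_adjoint A"
        by (intro sa.diff_S jordan_self_adjoint sum_A that x y)
    qed
    from UN_coset2[OF J, where g = jordan and x = x and y = y, OF this]
    show "coset J x \<otimes>\<^bsub>lie_jordan_quot L J\<^esub> coset J y = coset J (jordan x y)"
      by (simp add: lie_jordan_quot_def FactRing_def rcoset_mult_def cs mult)
    have "lie L (d + x) (e + y) - lie L x y \<in> J" if "d \<in> J" "e \<in> J" for d e
    proof (rule JI)
      have *: "lie L (d + x) (e + y) - lie L x y =
          lie_bracket lam (d + x) (e + y) - lie_bracket lam x y"
        using sa.lie_image sum_A that x y by simp
      \<comment> \<open>The first bracket is turned round, at the price of a sign, so that the
        element of \<open>D\<close> stands second as in \<open>lie_D\<close>.\<close>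
      also have "\<dots> = - lie_bracket lam (e + y) d + lie_bracket lam x e"
        by (simp add: lie_bracket_def scaleC_add_right scaleC_diff_right algebra_simps)
      also have "\<dots> \<in> D"
        using that xA yA JD by (intro add_D minus_D lie_D) (auto intro: add_A in_A)
      finally show "lie L (d + x) (e + y) - lie L x y \<in> D" .
      show "lie L (d + x) (e + y) - lie L x y \<in> self_adjoint A"
        unfolding * by (intro sa.diff_S lie_bracket_self_adjoint sum_A that x y)
    qed
    from UN_coset2[OF J, where g = "lie L" and x = x and y = y, OF this]
    show "lie (lie_jordan_quot L J) (coset J x) (coset J y) = coset J (lie_bracket lam x y)"
      using sa.lie_image[OF x y] by (simp add: lie_jordan_quot_def cs)
  next
    fix x r assume x: "x \<in> self_adjoint A"
    have "r *\<^sub>R (d + x) - r *\<^sub>R x \<in> J" if "d \<in> J" for d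
      using that subspace_scale[OF J] by (simp add: scaleR_add_right)
    from UN_coset[OF J, where g = "(*\<^sub>R) r" and x = x, OF this]
    show "r \<odot>\<^bsub>lie_jordan_quot L J\<^esub> coset J x = coset J (r *\<^sub>R x)"
      by (simp add: lie_jordan_quot_def coset_map_def cs smult)
    show "nrm (lie_jordan_quot L J) (coset J x) = infdist x D"
      using INF_norm_coset[OF J, of x] infdist_self_adjoint_D[of x] x
      by (simp add: lie_jordan_quot_def coset_nrm_def nrm J_def self_adjoint_def)
  next
    show "carrier (lie_jordan_quot L J) = coset J ` self_adjoint A"
      using sa.carrier_image by (auto simp: lie_jordan_quot_def FactRing_def A_RCOSETS_def' cs)
    show "\<zero>\<^bsub>lie_jordan_quot L J\<^esub> = coset J 0"
      by (simp add: lie_jordan_quot_def FactRing_def coset_def)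
    show "\<one>\<^bsub>lie_jordan_quot L J\<^esub> = coset J 1"
      using sa.one_image by (simp add: lie_jordan_quot_def FactRing_def cs)
  qed (rule lam)
qed

end

section \<open>Closed complex spans and the ideal \<open>D\<close>\<close>

lemma closed_cspan_linear_image:
  fixes g :: "'a::unital_cstar_algebra \<Rightarrow> 'a"
  assumes g: "continuous_on UNIV g" "\<And>x y. g (x + y) = g x + g y"
    "\<And>c x. \<exists>d. g (c *\<^sub>C x) = d *\<^sub>C g x" "\<And>x. x \<in> S \<Longrightarrow> g x \<in> T"
    and x: "x \<in> closed_cspan S"
  shows "g x \<in> closed_cspan T"
proof -
  have "g x \<in> cspan T" if "x \<in> cspan S" for x
    using that
  proof (induction rule: cvec.span_induct_alt)
    case base
    have "g 0 = 0" using g(2)[of 0 0] by simp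
    then show ?case by (simp add: cvec.span_zero)
  next
    \<comment> \<open>The scalar may change: it stays \<open>c\<close> for multiplications and
      becomes \<open>cnj c\<close> for the antilinear \<open>star\<close>.\<close>
    case (step c x y)
    obtain d where "g (c *\<^sub>C x) = d *\<^sub>C g x" using g(3) by blast
    then show ?case using step
      by (simp add: g(2) cvec.span_add cvec.span_scale cvec.span_base g(4))
  qed
  then have "g ` cspan S \<subseteq> closure (cspan T)" using closure_subset by blast
  then have "g ` closure (cspan S) \<subseteq> closure (cspan T)"
    by (intro image_closure_subset) (auto intro: continuous_on_subset[OF g(1)])
  with x show ?thesis by (auto simp: closed_cspan_def)
qed

lemma zero_closed_cspan: "0 \<in> closed_cspan S"
  using cvec.span_zero[of S] closure_subset by (auto simp: closed_cspan_def)

lemma closed_closed_cspan: "closed (closed_cspan S)"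
  by (simp add: closed_cspan_def)

lemma add_closed_cspan:
  fixes x y :: "'a::unital_cstar_algebra"
  assumes "x \<in> closed_cspan S" "y \<in> closed_cspan S"
  shows "x + y \<in> closed_cspan S"
proof -
  obtain u v where u: "\<And>n::nat. u n \<in> cspan S" "u \<longlonglongrightarrow> x" and v: "\<And>n. v n \<in> cspan S" "v \<longlonglongrightarrow> y"
    using assms by (auto simp: closed_cspan_def closure_sequential)
  then have "\<forall>n. u n + v n \<in> cspan S" "(\<lambda>n. u n + v n) \<longlonglongrightarrow> x + y"
    by (auto intro: cvec.span_add tendsto_add)
  then show ?thesis unfolding closed_cspan_def closure_sequential
    by (intro exI[of _ "\<lambda>n. u n + v n"] conjI)
qed

lemma scaleC_closed_cspan:
  assumes "x \<in> closed_cspan S"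
  shows "c *\<^sub>C x \<in> closed_cspan S"
proof -
  have "(*\<^sub>C) c ` cspan S \<subseteq> closure (cspan S)"
    using closure_subset cvec.span_scale by blast
  then have "(*\<^sub>C) c ` closure (cspan S) \<subseteq> closure (cspan S)"
    by (intro image_closure_subset closed_closure
        bounded_linear.continuous_on[OF bounded_linear_scaleC continuous_on_id])
  with assms show ?thesis by (auto simp: closed_cspan_def)
qed

text \<open>The first span is a closed left ideal and the second a closed right ideal of the whole
  algebra; \<open>star\<close> exchanges them because \<open>C\<close> is self-adjoint. The weak
  commutant supplies what \<open>D\<close> lacks for being two-sided.\<close>

lemma closed_star_ideal_weak_commutant:
  fixes C :: "'a::unital_cstar_algebra set"
  assumes C: "\<forall>c\<in>C. star c = c"
    and D: "D = closed_cspan {f * c | f c. c \<in> C} \<inter> closed_cspan {c * f | c f. c \<in> C}"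
  shows "closed_star_ideal (weak_commutant D) D"
proof -
  let ?FC = "{f * c | f c. c \<in> C}" and ?CF = "{c * f | c f. c \<in> C}"
  have FC: "y * x \<in> ?FC" if x: "x \<in> ?FC" for x y
  proof -
    obtain f c where "c \<in> C" "x = f * c" using x by blast
    then have "c \<in> C" "y * x = (y * f) * c" by (simp_all add: mult.assoc)
    then show ?thesis by blast
  qed
  have CF: "x * y \<in> ?CF" if x: "x \<in> ?CF" for x y
  proof -
    obtain f c where "c \<in> C" "x = c * f" using x by blast
    then have "c \<in> C" "x * y = c * (f * y)" by (simp_all add: mult.assoc)
    then show ?thesis by blast
  qed
  have left: "y * x \<in> closed_cspan ?FC" if "x \<in> closed_cspan ?FC" for x y
    by (rule closed_cspan_linear_image[OF _ _ _ FC that])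
      (auto intro!: continuous_intros simp: distrib_left mult_scaleC_right)
  have right: "x * y \<in> closed_cspan ?CF" if "x \<in> closed_cspan ?CF" for x y
    by (rule closed_cspan_linear_image[OF _ _ _ CF that])
      (auto intro!: continuous_intros simp: distrib_right mult_scaleC_left)
  have star_FC: "star x \<in> ?CF" if x: "x \<in> ?FC" for x
  proof -
    obtain f c where "c \<in> C" "x = f * c" using x by blast
    then have "c \<in> C" "star x = c * star f" using C by (simp_all add: star_mult)
    then show ?thesis by blast
  qed
  have star_CF: "star x \<in> ?FC" if x: "x \<in> ?CF" for x
  proof -
    obtain f c where "c \<in> C" "x = c * f" using x by blast
    then have "c \<in> C" "star x = star f * c" using C by (simp_all add: star_mult)
    then show ?thesis by blast
  qed
  have star1: "star x \<in> closed_cspan ?CF" if "x \<in> closed_cspan ?FC" for x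
    by (rule closed_cspan_linear_image[OF _ _ _ star_FC that])
      (auto intro!: continuous_on_star continuous_on_id simp: star_add star_scaleC)
  have star2: "star x \<in> closed_cspan ?FC" if "x \<in> closed_cspan ?CF" for x
    by (rule closed_cspan_linear_image[OF _ _ _ star_CF that])
      (auto intro!: continuous_on_star continuous_on_id simp: star_add star_scaleC)
  have closed_D: "closed D" unfolding D by (intro closed_Int closed_closed_cspan)
  have add: "x + y \<in> D" if "x \<in> D" "y \<in> D" for x y
    using that by (auto simp: D add_closed_cspan)
  have scaleD: "c *\<^sub>C x \<in> D" if "x \<in> D" for c x
    using that by (simp add: D scaleC_closed_cspan)
  have minus: "- x \<in> D" if "x \<in> D" for x
    using scaleD[OF that, of "- 1"] by (simp add: scaleC_minus_left)
  have diff: "x - y \<in> D" if "x \<in> D" "y \<in> D" for x y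
    using add[OF that(1) minus[OF that(2)]] by simp
  have star: "star x \<in> D" if "x \<in> D" for x
    using that star1 star2 by (auto simp: D)
  have mult_left: "x * d \<in> D" if "x \<in> weak_commutant D" "d \<in> D" for x d
  proof -
    have "x * d - d * x \<in> D" using that by (simp add: weak_commutant_def)
    \<comment> \<open>Membership of \<open>x * d\<close> in the right ideal is the half that fails
      for general \<open>x\<close>; it is recovered from \<open>d * x\<close> and the
      commutator.\<close>
    then have "(x * d - d * x) + d * x \<in> closed_cspan ?CF"
      using that(2) by (intro add_closed_cspan right) (auto simp: D)
    moreover have "x * d \<in> closed_cspan ?FC" using that(2) by (intro left) (auto simp: D)
    ultimately show ?thesis by (simp add: D)
  qed
  have mult_right: "d * x \<in> D" if "x \<in> weak_commutant D" "d \<in> D" for x d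
    using diff[OF mult_left[OF that], of "x * d - d * x"] that by (simp add: weak_commutant_def)
  show ?thesis
  proof
    have "weak_commutant D = (\<Inter>h\<in>D. (\<lambda>f. f * h - h * f) -` D)"
      by (auto simp: weak_commutant_def)
    also have "closed \<dots>"
      by (intro closed_INT ballI closed_vimage closed_D continuous_intros)
    finally show "closed (weak_commutant D)" .
    show zero: "0 \<in> D" by (simp add: D zero_closed_cspan)
    show "1 \<in> weak_commutant D" by (simp add: weak_commutant_def zero)
    show "x + y \<in> weak_commutant D" if "x \<in> weak_commutant D" "y \<in> weak_commutant D" for x y
    proof -
      have "(x + y) * h - h * (x + y) = (x * h - h * x) + (y * h - h * y)" for h
        by (simp add: algebra_simps)
      then show ?thesis using that by (simp add: weak_commutant_def add)
    qed
    \<comment> \<open>Both terms of the commutator of \<open>x * y\<close> lie in \<open>D\<close>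
      separately, by absorption.\<close>
    show "x * y \<in> weak_commutant D" if "x \<in> weak_commutant D" "y \<in> weak_commutant D" for x y
      unfolding weak_commutant_def using that
      by (auto intro!: diff simp: mult.assoc mult_left) (simp add: mult_right flip: mult.assoc)
    show "c *\<^sub>C x \<in> weak_commutant D" if "x \<in> weak_commutant D" for x c
      using that by (simp add: weak_commutant_def mult_scaleC_left mult_scaleC_right scaleD
          flip: scaleC_diff_right)
    show "star x \<in> weak_commutant D" if "x \<in> weak_commutant D" for x
    proof -
      have "star x * h - h * star x \<in> D" if h: "h \<in> D" for h
      proof -
        have "star x * h - h * star x = - star (x * star h - star h * x)"
          by (simp add: star_diff star_mult star_star)
        also have "\<dots> \<in> D"
          using \<open>x \<in> weak_commutant D\<close> star[OF h] by (intro minus star) (simp add: weak_commutant_def)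
        finally show ?thesis .
      qed
      then show ?thesis by (simp add: weak_commutant_def)
    qed
    show "D \<subseteq> weak_commutant D"
    proof
      fix d assume d: "d \<in> D"
      \<comment> \<open>The factor \<open>h\<close> puts the product into the left ideal, the factor
        \<open>d\<close> into the right ideal.\<close>
      have "d * h \<in> D" if "h \<in> D" "d \<in> D" for d h
        using left[of h d] right[of d h] that by (simp add: D)
      then show "d \<in> weak_commutant D" using d diff by (simp add: weak_commutant_def)
    qed
  qed (fact closed_D add mult_left mult_right star)+
qed

theorem theorem6:
  fixes C D Obs NJ J :: "'a::unital_cstar_algebra set" and lam :: real
  assumes C_sa: "\<forall>c\<in>C. star c = c"
    and lam: "lam \<noteq> 0"
    and D: "D = closed_cspan {f * c | f c. c \<in> C} \<inter> closed_cspan {c * f | c f. c \<in> C}"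
    and Obs: "Obs = weak_commutant D"
    and NJ: "NJ = self_adjoint Obs"
    and J: "J = self_adjoint D"
  shows "unital_cstar_algebra_on (cstar_sub Obs) \<and> closed Obs
    \<and> ideal D (cstar_sub Obs) \<and> closed D
    \<and> bij_betw (\<lambda>(a, b). a + \<i> *\<^sub>C b) (NJ \<times> NJ) Obs
    \<and> bij_betw (\<lambda>(a, b). a + \<i> *\<^sub>C b) (J \<times> J) D
    \<and> unital_cstar_algebra_on (cstar_quot (cstar_sub Obs) D)
    \<and> lie_jordan_banach_algebra (1 / (2 * lam)) (lie_jordan_quot (sa_part lam (cstar_sub Obs)) J)
    \<and> lie_jordan_banach_algebra (1 / (2 * lam)) (sa_part lam (cstar_quot (cstar_sub Obs) D))
    \<and> (\<exists>\<phi>. (\<forall>n\<in>NJ. \<phi> (J +>\<^bsub>sa_part lam (cstar_sub Obs)\<^esub> n) = D +>\<^bsub>cstar_sub Obs\<^esub> n)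
          \<and> lie_jordan_banach_iso \<phi> (lie_jordan_quot (sa_part lam (cstar_sub Obs)) J)
              (sa_part lam (cstar_quot (cstar_sub Obs) D)))"
proof -
  interpret closed_star_ideal Obs D
    unfolding Obs by (rule closed_star_ideal_weak_commutant[OF C_sa D])
  interpret sub: cstar_image Obs "{0}" "cstar_sub Obs" "\<lambda>x. x" by (rule cstar_image_cstar_sub)
  interpret quot: cstar_image Obs D "cstar_quot (cstar_sub Obs) D" "coset D"
    by (rule cstar_image_cstar_quot)
  let ?L = "lie_jordan_quot (sa_part lam (cstar_sub Obs)) J"
    and ?M = "sa_part lam (cstar_quot (cstar_sub Obs) D)"
  have L: "lie_jordan_image Obs D lam ?L (coset J)"
    unfolding J by (rule lie_jordan_image_lie_jordan_quot[OF lam])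
  have M: "lie_jordan_image Obs D lam ?M (coset D)"
    by (rule quot.lie_jordan_image_sa_part[OF lam])
  have cosets: "J +>\<^bsub>sa_part lam (cstar_sub Obs)\<^esub> n = coset J n"
    "D +>\<^bsub>cstar_sub Obs\<^esub> n = coset D n" for n
    by (rule a_r_coset_eq_coset, simp add: sa_part_def cstar_sub_def)+
  \<comment> \<open>Since \<open>J\<close> is contained in \<open>D\<close>, all elements of a coset
    of \<open>J\<close> have the same coset modulo \<open>D\<close>; the union returns it without
    choosing a representative.\<close>
  define \<phi> where "\<phi> S = (\<Union>x\<in>S. coset D x)" for S
  have \<phi>: "\<phi> (coset J n) = coset D n" for n
  proof -
    have "coset D x = coset D n" if "x \<in> coset J n" for x
      using that by (auto simp: coset_def J self_adjoint_def
          intro!: coset_eqI[OF subspace_D, unfolded coset_def])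
    moreover have "coset J n \<noteq> {}"
      using subspace_0[OF subspace_self_adjoint_D] by (auto simp: coset_def J)
    ultimately show ?thesis by (auto simp: \<phi>_def)
  qed
  have "lie_jordan_banach_iso \<phi> ?L ?M"
    by (rule lie_jordan_banach_iso_images[OF L M \<phi>])
  then have ex: "\<exists>\<phi>. (\<forall>n\<in>NJ. \<phi> (J +>\<^bsub>sa_part lam (cstar_sub Obs)\<^esub> n) = D +>\<^bsub>cstar_sub Obs\<^esub> n)
      \<and> lie_jordan_banach_iso \<phi> ?L ?M"
    using \<phi> cosets by auto
  have "bij_betw (\<lambda>(a, b). a + \<i> *\<^sub>C b) (NJ \<times> NJ) Obs"
    unfolding NJ by (rule bij_betw_add_i[OF scaleC_A add_A star_A])
  moreover have "bij_betw (\<lambda>(a, b). a + \<i> *\<^sub>C b) (J \<times> J) D"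
    unfolding J by (rule bij_betw_add_i[OF scaleC_D add_D star_D])
  ultimately show ?thesis
    using sub.unital_cstar_algebra_on_B closed_A ideal_D closed_D
      quot.unital_cstar_algebra_on_B lie_jordan_image.lie_jordan_banach_algebra_L[OF L]
      lie_jordan_image.lie_jordan_banach_algebra_L[OF M] ex
    by blast
qed

end
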